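(* Let $m\ge1$, $N=2^m$, and let $M=[\,M_\infty\mid M_0\mid\cdots\mid M_z\mid\cdots\,]$ be the $N\times N(N+1)$ matrix whose blocks are the Kerdock mutually unbiased bases $M_\infty$ and $M_z$, $z\in\mathbb{F}_{2^m}$. For any symmetry $(U,G)$ of $M$, the unitary matrix $U$ is an element of the Clifford group $\mathrm{Cliff}_N$.
   Context: Field setup: $\mathbb{F}_{2^m}$ is obtained from $\mathbb{F}_2$ by adjoining a root $\alpha$ of a primitive irreducible polynomial of degree $m$; the element $z_0+z_1\alpha+\cdots+z_{m-1}\alpha^{m-1}$ is identified with the row vector $[z_0,\ldots,z_{m-1}]\in\mathbb{F}_2^m$. $W$ is the binary symmetric matrix with $\mathrm{Tr}(xy)=xWy^T$ (field trace to $\mathbb{F}_2$), $A_z$ is the binary matrix of multiplication by $z$: $xA_z=xz$. Kerdock matrices: $P_z=A_zW$. Coordinates of $\mathbb{C}^N$ are indexed by $\mathbb{F}_2^m$. $H_N$ is the Walsh-Hadamard matrix $[H_N]_{x,y}=\frac{1}{\sqrt N}(-1)^{xy^T}$. $M_z=\mathrm{diag}(\imath^{xP_zx^T})_{x\in\mathbb{F}_2^m}H_N$ for $z\in\mathbb{F}_{2^m}$ (exponent computed with integer $0,1$ entries modulo 4), and $M_\infty=I_N$. A symmetry of $M$ is a pair $(U,G)$ with $UMG=M$, where $U$ is an $N\times N$ unitary matrix and $G=\Pi D$ with $\Pi$ a permutation matrix and $D$ a diagonal matrix with diagonal entries in $\{1,\imath,-1,-\imath\}$. With $X=\begin{bmatrix}0&1\\1&0\end{bmatrix}$,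 $Z=\begin{bmatrix}1&0\\0&-1\end{bmatrix}$, $D(a,b)=X^{a_1}Z^{b_1}\otimes\cdots\otimes X^{a_m}Z^{b_m}$ for $a,b\in\mathbb{F}_2^m$, and $HW_N=\{\imath^\kappa D(a,b)\}$, the Clifford group $\mathrm{Cliff}_N$ is the set of all $N\times N$ unitary matrices $g$ with $gD(a,b)g^\dagger\in HW_N$ for all $a,b$. *)

theory Defs
  imports
    "HOL-Library.Z2"
    "HOL-Computational_Algebra.Polynomial_Factorial"
    "HOL-Combinatorics.Permutations"
    "Jordan_Normal_Form.Schur_Decomposition"
begin

text \<open>
  The field \<open>GF(2^m)\<close> is \<open>GF(2)[x]\<close> modulo a primitive polynomial \<open>p\<close> of degree \<open>m\<close>; the adjoined
  root \<open>\<alpha>\<close> is the class of \<open>x\<close>. Field elements are stored as row vectors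
  \<open>[z\<^sub>0, \<dots>, z\<^bsub>m-1\<^esub>]\<close> of coordinates with respect to \<open>1, \<alpha>, \<dots>, \<alpha>^(m-1)\<close>, so that
  \<open>unit_vec m i\<close> is \<open>\<alpha>^i\<close> for \<open>i < m\<close>.
\<close>

text \<open>Primitive: irreducible, and the powers of the root are exactly the nonzero field elements.\<close>

definition primitive_irred :: "bit poly \<Rightarrow> bool" where
  "primitive_irred p \<longleftrightarrow> irreducible p \<and>
     {[:0, 1:] ^ k mod p | k :: nat. True} = {q. q \<noteq> 0 \<and> degree q < degree p}"

definition poly_of_row :: "bit vec \<Rightarrow> bit poly" where
  "poly_of_row z = (\<Sum>i<dim_vec z. monom (z $ i) i)"

definition row_of_poly :: "nat \<Rightarrow> bit poly \<Rightarrow> bit vec" where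
  "row_of_poly m q = vec m (coeff q)"

definition gf_mult :: "bit poly \<Rightarrow> bit vec \<Rightarrow> bit vec \<Rightarrow> bit vec" where
  "gf_mult p x y = row_of_poly (degree p) ((poly_of_row x * poly_of_row y) mod p)"

text \<open>
  The trace is \<open>Tr(z) = z + z^2 + z^4 + \<dots> + z^(2^(m-1))\<close>. This field element lies in the prime field
  (lemma \<open>gf_trace_in_prime_field\<close> below), so as an element of \<open>GF(2)\<close> it is its own
  constant coefficient.
\<close>

definition tr_poly :: "bit poly \<Rightarrow> bit poly \<Rightarrow> bit poly" where
  "tr_poly p q = (\<Sum>k<degree p. q ^ (2 ^ k)) mod p"

definition gf_trace :: "bit poly \<Rightarrow> bit vec \<Rightarrow> bit" where
  "gf_trace p z = coeff (tr_poly p (poly_of_row z)) 0"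

text \<open>
  \<open>A\<^sub>z\<close> and \<open>W\<close>, given by their values on basis vectors; the characterisations \<open>x A\<^sub>z = x z\<close> and
  \<open>Tr(x y) = x W y\<^sup>T\<close> are lemmas \<open>gf_mult_mat\<close> and \<open>gf_trace_mult\<close> below.
\<close>

definition gf_mat :: "bit poly \<Rightarrow> bit vec \<Rightarrow> bit mat" where
  "gf_mat p z = mat_of_rows (degree p)
     (map (\<lambda>i. gf_mult p (unit_vec (degree p) i) z) [0..<degree p])"

definition trace_mat :: "bit poly \<Rightarrow> bit mat" where
  "trace_mat p = mat (degree p) (degree p)
     (\<lambda>(i, j). gf_trace p (gf_mult p (unit_vec (degree p) i) (unit_vec (degree p) j)))"

lemma sum_mod_poly:
  fixes f :: "'b \<Rightarrow> bit poly"
  shows "(\<Sum>i\<in>S. f i) mod p = (\<Sum>i\<in>S. f i mod p)"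
  by (induction S rule: infinite_finite_induct) (simp_all add: poly_mod_add_left)

lemma coeff_poly_of_row: "coeff (poly_of_row z) i = (if i < dim_vec z then z $ i else 0)"
  by (auto simp: poly_of_row_def coeff_sum)

lemma poly_of_row_unit: "i < m \<Longrightarrow> poly_of_row (unit_vec m i) = monom 1 i"
  by (rule poly_eqI) (auto simp: coeff_poly_of_row)

lemma poly_of_row_of_poly:
  assumes "degree q < m \<or> q = 0"
  shows "poly_of_row (row_of_poly m q) = q"
  using assms by (intro poly_eqI) (auto simp: coeff_poly_of_row row_of_poly_def coeff_eq_0)

lemma gf_mult_mat:
  assumes x: "x \<in> carrier_vec (degree p)"
  shows "(gf_mat p z)\<^sup>T *\<^sub>v x = gf_mult p x z"
proof (rule eq_vecI)
  fix j assume "j < dim_vec (gf_mult p x z)"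
  hence j: "j < degree p" by (simp add: gf_mult_def row_of_poly_def)
  have dx: "dim_vec x = degree p" using x by auto
  have "((gf_mat p z)\<^sup>T *\<^sub>v x) $ j = (\<Sum>i<degree p. x $ i * coeff ((monom 1 i * poly_of_row z) mod p) j)"
    using j x by (auto simp: gf_mat_def scalar_prod_def gf_mult_def row_of_poly_def mat_of_rows_index
        poly_of_row_unit lessThan_atLeast0 mult.commute intro!: sum.cong simp del: mult_bit_eq_and)
  also have "\<dots> = (\<Sum>i<degree p. coeff ((monom (x $ i) i * poly_of_row z) mod p) j)"
  proof (rule sum.cong[OF refl])
    fix i
    have "monom (x $ i) i * poly_of_row z = smult (x $ i) (monom 1 i * poly_of_row z)"
      by (metis mult_smult_left smult_monom mult.right_neutral)
    thus "x $ i * coeff ((monom 1 i * poly_of_row z) mod p) j = coeff ((monom (x $ i) i * poly_of_row z) mod p) j"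
      by (simp add: mod_smult_left)
  qed
  also have "\<dots> = coeff ((poly_of_row x * poly_of_row z) mod p) j"
    by (simp only: poly_of_row_def[of x] dx sum_distrib_right sum_mod_poly coeff_sum)
  finally show "((gf_mat p z)\<^sup>T *\<^sub>v x) $ j = gf_mult p x z $ j"
    using j by (simp add: gf_mult_def row_of_poly_def)
qed (simp add: gf_mat_def gf_mult_def row_of_poly_def)

lemma frobenius_add: "(a + b) ^ (2 ^ k) = a ^ (2 ^ k) + (b :: bit poly) ^ (2 ^ k)"
proof (induction k)
  case (Suc k)
  have "2 = (0 :: bit poly)"
    by (simp add: numeral_poly)
  hence *: "(c + d)\<^sup>2 = c\<^sup>2 + d\<^sup>2" for c d :: "bit poly" by (simp add: power2_sum)
  have s: "q ^ (2 ^ Suc k) = (q ^ (2 ^ k))\<^sup>2" for q :: "bit poly"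
    by (simp add: power_mult[symmetric] mult.commute)
  show ?case by (simp only: s Suc *)
qed simp

lemma frobenius_sum: "(\<Sum>i\<in>S. f i) ^ (2 ^ k) = (\<Sum>i\<in>S. (f i :: bit poly) ^ (2 ^ k))"
  by (induction S rule: infinite_finite_induct) (simp_all add: frobenius_add)


lemma tr_poly_mod: "tr_poly p (q mod p) = tr_poly p q"
  by (simp add: tr_poly_def sum_mod_poly power_mod)

lemma tr_poly_sum: "tr_poly p (\<Sum>i\<in>S. f i) = (\<Sum>i\<in>S. tr_poly p (f i))"
  by (simp add: tr_poly_def frobenius_sum sum_mod_poly) (rule sum.swap)

lemma tr_poly_smult: "tr_poly p (smult c q) = smult c (tr_poly p q)"
proof (cases "c = 0")
  case True thus ?thesis by (simp add: tr_poly_def zero_power)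
qed simp

lemma tr_poly_gf_mult:
  assumes "degree p > 0"
  shows "tr_poly p (poly_of_row (gf_mult p x y)) = tr_poly p (poly_of_row x * poly_of_row y)"
proof -
  have "degree (q mod p) < degree p" for q
    using assms degree_mod_less' [of p q] by (cases "q mod p = 0"; cases "p = 0") auto
  thus ?thesis
    by (simp add: gf_mult_def poly_of_row_of_poly tr_poly_mod)
qed

lemma gf_trace_mult:
  assumes p: "degree p > 0" and x: "x \<in> carrier_vec (degree p)" and y: "y \<in> carrier_vec (degree p)"
  shows "gf_trace p (gf_mult p x y) = x \<bullet> (trace_mat p *\<^sub>v y)"
proof -
  let ?m = "degree p"
  have d: "dim_vec x = ?m" "dim_vec y = ?m" using x y by auto
  have W: "trace_mat p $$ (i, j) = coeff (tr_poly p (monom 1 i * monom 1 j)) 0" if "i < ?m" "j < ?m" for i j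
    using that p by (simp add: trace_mat_def gf_trace_def tr_poly_gf_mult poly_of_row_unit)
  have M: "monom a i * monom b j = smult (a * b) (monom 1 i * monom 1 j)" for a b :: bit and i j
    by (simp add: mult_monom smult_monom del: mult_bit_eq_and)
  have "poly_of_row x * poly_of_row y = (\<Sum>i<?m. \<Sum>j<?m. smult (x $ i * y $ j) (monom 1 i * monom 1 j))"
    unfolding poly_of_row_def d sum_product by (intro sum.cong refl M)
  hence "gf_trace p (gf_mult p x y) = (\<Sum>i<?m. \<Sum>j<?m. x $ i * y $ j * coeff (tr_poly p (monom 1 i * monom 1 j)) 0)"
    by (simp only: gf_trace_def tr_poly_gf_mult[OF p] tr_poly_sum tr_poly_smult coeff_sum coeff_smult)
  also have "\<dots> = (\<Sum>i<?m. x $ i * (\<Sum>j<?m. trace_mat p $$ (i, j) * y $ j))"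
    by (simp add: sum_distrib_left W mult_ac del: mult_bit_eq_and)
  also have "\<dots> = x \<bullet> (trace_mat p *\<^sub>v y)"
    using d by (simp add: scalar_prod_def trace_mat_def lessThan_atLeast0 del: mult_bit_eq_and)
  finally show ?thesis .
qed

lemma trace_mat_symmetric: "(trace_mat p)\<^sup>T = trace_mat p"
  by (rule eq_matI) (auto simp: trace_mat_def gf_mult_def mult.commute)

lemma finite_card_residues:
  "finite {q :: bit poly. q = 0 \<or> degree q < m}" "card {q :: bit poly. q = 0 \<or> degree q < m} = 2 ^ m"
proof -
  have c: "coeff (\<Sum>i\<in>S. monom 1 i :: bit poly) j = (if j \<in> S then 1 else 0)" if "S \<subseteq> {..<m}" for S j
    using finite_subset[OF that] by (auto simp: coeff_sum)
  have b: "bij_betw (\<lambda>S. \<Sum>i\<in>S. monom 1 i :: bit poly) (Pow {..<m}) {q. q = 0 \<or> degree q < m}"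
  proof (rule bij_betw_byWitness[where f' = "\<lambda>q. {i. coeff q i = 1}"])
    show "\<forall>S\<in>Pow {..<m}. {i. coeff (\<Sum>i\<in>S. monom 1 i :: bit poly) i = 1} = S"
      using c by auto
    have deg: "{i. coeff q i = 1} \<subseteq> {..<m}" if "q = 0 \<or> degree q < m" for q :: "bit poly"
      using that le_degree[of q] by (auto simp: not_less intro: ccontr) 
        (metis le_degree leD le_less_trans not_less zero_neq_one)
    show "(\<lambda>q. {i. coeff q i = 1}) ` {q :: bit poly. q = 0 \<or> degree q < m} \<subseteq> Pow {..<m}"
      using deg by auto
    show "\<forall>q\<in>{q :: bit poly. q = 0 \<or> degree q < m}. (\<Sum>i\<in>{i. coeff q i = 1}. monom 1 i) = q"
      using deg c by (auto intro!: poly_eqI)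
    have "(\<Sum>i\<in>S. monom 1 i :: bit poly) = 0 \<or> degree (\<Sum>i\<in>S. monom 1 i :: bit poly) < m" if "S \<subseteq> {..<m}" for S
      by (metis c leading_coeff_0_iff lessThan_iff subsetD that)
    thus "(\<lambda>S. \<Sum>i\<in>S. monom 1 i :: bit poly) ` Pow {..<m} \<subseteq> {q. q = 0 \<or> degree q < m}" by auto
  qed
  show "finite {q :: bit poly. q = 0 \<or> degree q < m}" using bij_betw_finite[OF b] by simp
  show "card {q :: bit poly. q = 0 \<or> degree q < m} = 2 ^ m"
    using bij_betw_same_card[OF b] by (simp add: card_Pow)
qed

lemma fermat_poly:
  assumes p: "irreducible p" and q: "\<not> p dvd q"
  shows "p dvd q ^ (2 ^ degree p - 1) - (1 :: bit poly)"
proof -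
  let ?R = "{r :: bit poly. r \<noteq> 0 \<and> degree r < degree p}"
  let ?f = "\<lambda>r. (q * r) mod p"
  have pe: "prime_elem p" using p by (rule field_poly_irreducible_imp_prime)
  have p0: "p \<noteq> 0" using p by auto
  have pd: "degree p > 0" using p 
    by (metis gr0I irreducible_def is_unit_iff_degree)
  have nd: "\<not> p dvd r" if "r \<in> ?R" for r using that dvd_imp_degree_le[of p r] by auto
  have R: "?R = {q. q = 0 \<or> degree q < degree p} - {0}" by auto
  have fin: "finite ?R" unfolding R using finite_card_residues(1) by simp
  have cR: "card ?R = 2 ^ degree p - 1" unfolding R
    using finite_card_residues[of "degree p"] by (subst card_Diff_singleton) auto
  have inj: "inj_on ?f ?R"
  proof (rule inj_onI)
    fix r s assume r: "r \<in> ?R" and s: "s \<in> ?R" and e: "?f r = ?f s"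
    have "p dvd q * r - q * s" using e by (simp add: mod_eq_dvd_iff)
    hence "p dvd q * (r - s)" by (simp add: algebra_simps)
    hence "p dvd r - s" using pe q prime_elem_dvd_mult_iff by blast
    moreover have "degree (r - s) < degree p" using r s by (auto intro: degree_diff_less)
    ultimately show "r = s" using dvd_imp_degree_le[of p "r - s"] by auto
  qed
  have sub: "?f ` ?R \<subseteq> ?R"
  proof (rule image_subsetI)
    fix r assume r: "r \<in> ?R"
    have "\<not> p dvd q * r" using nd[OF r] pe q prime_elem_dvd_mult_iff by blast
    hence "?f r \<noteq> 0" by (simp add: dvd_eq_mod_eq_0)
    thus "?f r \<in> ?R" using degree_mod_less'[OF p0] by blast
  qed
  have im: "?f ` ?R = ?R" using endo_inj_surj[OF fin sub inj] .
  have "(\<Prod>r\<in>?R. q * r) mod p = (\<Prod>r\<in>?R. ?f r) mod p" by (simp add: mod_prod_eq)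
  also have "(\<Prod>r\<in>?R. ?f r) = \<Prod>(?f ` ?R)" using prod.reindex[OF inj, of "\<lambda>x. x"] by simp
  also have "\<dots> = \<Prod>?R" by (simp only: im)
  finally have "p dvd (\<Prod>r\<in>?R. q * r) - \<Prod>?R" by (simp add: mod_eq_dvd_iff)
  hence "p dvd (q ^ card ?R - 1) * \<Prod>?R" by (simp add: prod.distrib algebra_simps)
  moreover have "\<not> p dvd \<Prod>S" if "finite S" "\<forall>r\<in>S. \<not> p dvd r" for S
    using that pe pd by (induction S) (auto simp: prime_elem_dvd_mult_iff)
  hence "\<not> p dvd \<Prod>?R" using fin nd by blast
  ultimately have "p dvd q ^ card ?R - 1" using pe prime_elem_dvd_mult_iff by blast
  thus ?thesis by (simp add: cR)
qed

lemma gf_trace_in_prime_field: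
  assumes p: "irreducible p"
  shows "tr_poly p (poly_of_row z) = [:gf_trace p z:]"
proof -
  define q where "q = poly_of_row z"
  define t where "t = (\<Sum>k<degree p. q ^ (2 ^ k))"
  have pe: "prime_elem p" using p by (rule field_poly_irreducible_imp_prime)
  have p0: "p \<noteq> 0" using p by auto
  have pd: "degree p > 0" using p 
    by (metis gr0I irreducible_def is_unit_iff_degree)
  have "t\<^sup>2 = (\<Sum>k<degree p. q ^ (2 ^ Suc k))"
    using frobenius_sum[of "\<lambda>k. q ^ (2 ^ k)" "{..<degree p}" 1]
    by (simp add: t_def power_mult[symmetric] mult.commute)
  also have "\<dots> = t + (q ^ (2 ^ degree p) - q)"
    using sum_lessThan_telescope[of "\<lambda>k. q ^ (2 ^ k)" "degree p"]
    by (simp add: t_def sum_subtractf algebra_simps)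
  finally have "t * (t - 1) = q ^ (2 ^ degree p) - q" by (simp add: power2_eq_square algebra_simps)
  also have "\<dots> = q * (q ^ (2 ^ degree p - 1) - 1)"
    by (simp add: algebra_simps power_eq_if[of q "2 ^ degree p"])
  also have "p dvd \<dots>" using fermat_poly[OF p, of q]
    by (cases "p dvd q") auto
  finally have "p dvd t \<or> p dvd t - 1" using pe prime_elem_dvd_mult_iff by blast
  hence "t mod p = 0 \<or> t mod p = 1 mod p"
    by (auto simp: dvd_eq_mod_eq_0 mod_eq_dvd_iff)
  moreover have "1 mod p = 1" using pd by (simp add: mod_poly_less)
  ultimately have "tr_poly p (poly_of_row z) \<in> {0, 1}" by (auto simp: tr_poly_def t_def q_def)
  thus ?thesis by (auto simp: gf_trace_def one_pCons)
qed

definition kerdock_P :: "bit poly \<Rightarrow> bit vec \<Rightarrow> bit mat" where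
  "kerdock_P p z = gf_mat p z * trace_mat p"

text \<open>
  The positions \<open>0, \<dots>, 2^m - 1\<close> are labelled by \<open>GF(2)^m\<close> through the binary expansion with \<open>x\<^sub>0\<close> the
  most significant bit; this is the ordering compatible with Kronecker products
  (first factor = coordinate \<open>0\<close>).
\<close>

definition bin_label :: "nat \<Rightarrow> nat \<Rightarrow> bit vec" where
  "bin_label m k = vec m (\<lambda>i. of_nat (k div 2 ^ (m - 1 - i)))"

definition bit_nat :: "bit \<Rightarrow> nat" where
  "bit_nat b = (if b = 1 then 1 else 0)"

definition int_quad_form :: "bit mat \<Rightarrow> bit vec \<Rightarrow> nat" where
  "int_quad_form P x =
     (\<Sum>i<dim_vec x. \<Sum>j<dim_vec x. bit_nat (x $ i) * bit_nat (P $$ (i, j)) * bit_nat (x $ j))"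

definition walsh_hadamard :: "nat \<Rightarrow> complex mat" where
  "walsh_hadamard m = mat (2 ^ m) (2 ^ m)
     (\<lambda>(k, l). (- 1) ^ bit_nat (bin_label m k \<bullet> bin_label m l) / complex_of_real (sqrt (2 ^ m)))"

definition kerdock_basis :: "bit poly \<Rightarrow> bit vec \<Rightarrow> complex mat" where
  "kerdock_basis p z =
     mat_diag (2 ^ degree p) (\<lambda>k. \<i> ^ int_quad_form (kerdock_P p z) (bin_label (degree p) k))
       * walsh_hadamard (degree p)"

definition hconcat :: "nat \<Rightarrow> complex mat list \<Rightarrow> complex mat" where
  "hconcat n Bs = mat_of_cols n (concat (map cols Bs))"

definition kerdock_mubs :: "bit poly \<Rightarrow> complex mat" where
  "kerdock_mubs p = (let m = degree p; N = 2 ^ m in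
     hconcat N (1\<^sub>m N # map (\<lambda>k. kerdock_basis p (bin_label m k)) [0..<N]))"

definition unitary_mats :: "nat \<Rightarrow> complex mat set" where
  "unitary_mats n = {U \<in> carrier_mat n n. U * mat_adjoint U = 1\<^sub>m n \<and> mat_adjoint U * U = 1\<^sub>m n}"

definition permutation_mats :: "nat \<Rightarrow> complex mat set" where
  "permutation_mats n =
     {mat n n (\<lambda>(i, j). if i = \<pi> j then 1 else 0) | \<pi>. \<pi> permutes {..<n}}"

definition quaternary_diag_mats :: "nat \<Rightarrow> complex mat set" where
  "quaternary_diag_mats n = {mat_diag n d | d. \<forall>j<n. d j \<in> {1, \<i>, - 1, - \<i>}}"

definition is_symmetry :: "complex mat \<Rightarrow> complex mat \<Rightarrow> complex mat \<Rightarrow> bool" where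
  "is_symmetry M U G \<longleftrightarrow>
     U \<in> unitary_mats (dim_row M) \<and>
     (\<exists>Q \<in> permutation_mats (dim_col M). \<exists>D \<in> quaternary_diag_mats (dim_col M). G = Q * D) \<and>
     U * M * G = M"

definition kronecker :: "complex mat \<Rightarrow> complex mat \<Rightarrow> complex mat" where
  "kronecker A B = mat (dim_row A * dim_row B) (dim_col A * dim_col B)
     (\<lambda>(i, j). A $$ (i div dim_row B, j div dim_col B) * B $$ (i mod dim_row B, j mod dim_col B))"

definition pauli_X :: "complex mat" where
  "pauli_X = mat_of_rows_list 2 [[0, 1], [1, 0]]"

definition pauli_Z :: "complex mat" where
  "pauli_Z = mat_of_rows_list 2 [[1, 0], [0, - 1]]"

definition pauli_D :: "nat \<Rightarrow> bit vec \<Rightarrow> bit vec \<Rightarrow> complex mat" where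
  "pauli_D m a b = foldr kronecker
     (map (\<lambda>i. (pauli_X ^\<^sub>m bit_nat (a $ i)) * (pauli_Z ^\<^sub>m bit_nat (b $ i))) [0..<m]) (1\<^sub>m 1)"

definition heisenberg_weyl :: "nat \<Rightarrow> complex mat set" where
  "heisenberg_weyl m =
     {\<i> ^ \<kappa> \<cdot>\<^sub>m pauli_D m a b | \<kappa> a b. \<kappa> < (4 :: nat) \<and> a \<in> carrier_vec m \<and> b \<in> carrier_vec m}"

definition clifford :: "nat \<Rightarrow> complex mat set" where
  "clifford m = {g \<in> unitary_mats (2 ^ m).
     \<forall>a \<in> carrier_vec m. \<forall>b \<in> carrier_vec m.
       g * pauli_D m a b * mat_adjoint g \<in> heisenberg_weyl m}"

end

theory Submission
  imports Defs
begin

text \<open>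
  The symmetry permutes the lines spanned by the columns of the Kerdock matrix. Two of these lines
  are orthogonal only if they belong to the same basis, so \<open>U\<close> and its adjoint permute the bases.
  Every Pauli matrix \<open>D\<close> maps each basis to itself up to phases and is diagonal in one of them
  (\<open>D(0,b)\<close> in the standard basis, \<open>D(a, a P\<^sub>z)\<close> in the basis \<open>M\<^sub>z\<close>; nondegeneracy of the trace shows
  that this covers all Pauli matrices). Both properties pass to the conjugate \<open>E\<close> of \<open>D\<close> by \<open>U\<close>. If
  \<open>E\<close> is diagonal in a basis \<open>B\<close>, choose a vector \<open>v\<close> of another basis and a Pauli matrix diagonal
  in \<open>B\<close> that acts on \<open>v\<close> like \<open>E\<close> up to a phase; the eigenvalues on \<open>B\<close> of the two operators are
  then proportional, so \<open>E\<close> is a phase times a Pauli matrix.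
\<close>

section \<open>The trace form\<close>

text \<open>Dedekind's argument for the independence of the automorphisms \<open>x \<mapsto> x^(2^k)\<close>: replace \<open>x\<close> by \<open>t x\<close> and eliminate the last term.\<close>

lemma frobenius_power_independent:
  fixes p t :: "bit poly" and c :: "nat \<Rightarrow> bit poly"
  assumes p: "prime_elem p"
    and t: "\<And>i j. i < j \<Longrightarrow> j < n \<Longrightarrow> \<not> p dvd t ^ (2 ^ i) - t ^ (2 ^ j)"
    and z: "\<And>x. p dvd (\<Sum>k<n. c k * x ^ (2 ^ k))"
    and k: "k < n"
  shows "p dvd c k"
  using t z k
proof (induction n arbitrary: c k)
  case (Suc n)
  have low: "p dvd c k" if "k < n" for k
  proof -
    have "p dvd (\<Sum>k<n. (c k * (t ^ (2 ^ k) - t ^ (2 ^ n))) * x ^ (2 ^ k))" for x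
    proof -
      have "p dvd (\<Sum>k<Suc n. c k * (t * x) ^ (2 ^ k)) - t ^ (2 ^ n) * (\<Sum>k<Suc n. c k * x ^ (2 ^ k))"
        by (intro dvd_diff dvd_mult Suc.prems)
      also have "\<dots> = (\<Sum>k<n. (c k * (t ^ (2 ^ k) - t ^ (2 ^ n))) * x ^ (2 ^ k))"
        by (simp add: sum_distrib_left sum_subtractf[symmetric] power_mult_distrib algebra_simps)
      finally show ?thesis .
    qed
    hence "p dvd c k * (t ^ (2 ^ k) - t ^ (2 ^ n))"
      using Suc.IH[of "\<lambda>k. c k * (t ^ (2 ^ k) - t ^ (2 ^ n))" k] Suc.prems(1) that by auto
    thus ?thesis using Suc.prems(1)[of k n] that p prime_elem_dvd_mult_iff by blast
  qed
  show ?case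
  proof (cases "k = n")
    case True
    have "p dvd (\<Sum>k<n. c k) + c n" using Suc.prems(2)[of 1] by simp
    moreover have "p dvd (\<Sum>k<n. c k)" using low by (intro dvd_sum) auto
    ultimately show ?thesis using True by (simp add: dvd_add_right_iff)
  next
    case False
    thus ?thesis using low Suc.prems(3) by auto
  qed
qed simp

text \<open>A repetition at position \<open>j\<close> would send every later power of the root back
  among the first \<open>j\<close> residues, whereas primitivity demands all
  \<open>2 ^ degree p - 1\<close> nonzero ones.\<close>

lemma primitive_powers_distinct:
  assumes "primitive_irred p" and ij: "i < j" "j < 2 ^ degree p - 1"
  shows "\<not> p dvd [:0, 1:] ^ i - [:0, 1:] ^ j"
proof
  let ?x = "[:0, 1:] :: bit poly"
  let ?R = "{q :: bit poly. q \<noteq> 0 \<and> degree q < degree p}"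
  let ?S = "(\<lambda>k. ?x ^ k mod p) ` {..<j}"
  assume "p dvd ?x ^ i - ?x ^ j"
  hence e: "?x ^ j mod p = ?x ^ i mod p" by (metis mod_eq_dvd_iff)
  \<comment> \<open>The first \<open>j\<close> residues are closed under multiplication by the root:
    exponent \<open>j\<close> wraps around to \<open>i\<close>.\<close>
  have mem: "?x ^ k mod p \<in> ?S" for k
  proof (induction k)
    case 0
    show ?case using ij by (intro image_eqI[of _ _ 0]) auto
  next
    case (Suc k)
    then obtain l where l: "l < j" "?x ^ k mod p = ?x ^ l mod p" by auto
    have "?x ^ Suc k mod p = ?x ^ Suc l mod p"
      using l(2) by (metis mod_mult_right_eq power_Suc)
    also have "\<dots> \<in> ?S"
    proof (cases "Suc l = j")
      case True
      thus ?thesis using e ij by auto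
    next
      case False
      hence "Suc l < j" using l(1) by simp
      thus ?thesis by blast
    qed
    finally show ?case .
  qed
  have "{?x ^ k mod p | k :: nat. True} \<subseteq> ?S" by (rule subsetI, elim CollectE exE) (simp only: mem)
  moreover have "{?x ^ k mod p | k :: nat. True} = ?R" using assms(1) unfolding primitive_irred_def by (rule conjunct2)
  ultimately have "?R \<subseteq> ?S" by simp
  hence "card ?R \<le> card ?S" by (rule card_mono[rotated]) simp
  also have "card ?S \<le> card {..<j}" by (rule card_image_le) simp
  finally have "card ?R \<le> j" by simp
  moreover have R: "?R = {q. q = 0 \<or> degree q < degree p} - {0}" by auto
  have "card ?R = 2 ^ degree p - 1" unfolding R
    using finite_card_residues[of "degree p"] by (subst card_Diff_singleton) auto
  ultimately show False using ij by linarith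
qed

lemma irreducible_degree_pos:
  fixes p :: "'a :: field poly"
  shows "irreducible p \<Longrightarrow> degree p > 0"
  by (metis gr0I irreducible_def is_unit_iff_degree)

text \<open>If the trace killed every multiple of \<open>c\<close>, the powers
  \<open>x ^ (2 ^ k)\<close> would satisfy a linear relation with coefficients
  \<open>c ^ (2 ^ k)\<close>. The root of the primitive polynomial separates the Frobenius maps, so
  they are independent and \<open>p\<close> divides the coefficient with \<open>k = 0\<close>, which
  is \<open>c\<close>.\<close>

lemma tr_poly_nondegenerate:
  assumes "primitive_irred p" and c: "\<not> p dvd c"
  shows "\<exists>x. tr_poly p (c * x) \<noteq> 0"
proof (rule ccontr)
  assume "\<nexists>x. tr_poly p (c * x) \<noteq> 0"
  hence z: "p dvd (\<Sum>k<degree p. c ^ (2 ^ k) * x ^ (2 ^ k))" for x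
    by (simp add: tr_poly_def dvd_eq_mod_eq_0 power_mult_distrib)
  have irr: "irreducible p" using assms(1) by (simp add: primitive_irred_def)
  have pe: "prime_elem p" using irr by (rule field_poly_irreducible_imp_prime)
  have "\<not> p dvd [:0, 1:] ^ (2 ^ i) - [:0, 1:] ^ (2 ^ j)" if "i < j" "j < degree p" for i j
  proof (rule primitive_powers_distinct[OF assms(1)])
    \<comment> \<open>Half of \<open>2 ^ degree p\<close> lies below \<open>2 ^ degree p - 1\<close>
      only if it is at least 2; \<open>i < j\<close> and \<open>j < degree p\<close> ensure
      this.\<close>
    have *: "a < n - 1" if "a \<le> h" "2 \<le> h" "n = 2 * h" for a h n :: nat using that by linarith
    have "(2 :: nat) ^ j \<le> 2 ^ (degree p - 1)" "(2 :: nat) \<le> 2 ^ (degree p - 1)"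
      using that power_increasing[of 1 "degree p - 1" "2 :: nat"] by auto
    moreover have "(2 :: nat) ^ degree p = 2 * 2 ^ (degree p - 1)"
      using that by (metis less_nat_zero_code power_eq_if)
    ultimately show "(2 :: nat) ^ j < 2 ^ degree p - 1" by (rule *)
  qed (use that in simp)
  hence "p dvd c ^ (2 ^ 0)"
    using irreducible_degree_pos[OF irr] by (intro frobenius_power_independent[OF pe _ z]) auto
  thus False using c by simp
qed

text \<open>The trace depends only on the residue of \<open>q\<close>, and every residue is
  represented by a row, where \<open>gf_trace_in_prime_field\<close> applies.\<close>

lemma tr_poly_const:
  assumes "irreducible p"
  shows "tr_poly p q = [:coeff (tr_poly p q) 0:]"
proof -
  have "p \<noteq> 0" using assms by auto
  hence "poly_of_row (row_of_poly (degree p) (q mod p)) = q mod p"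
    using degree_mod_less[of p q] by (intro poly_of_row_of_poly) auto
  thus ?thesis
    using gf_trace_in_prime_field[OF assms, of "row_of_poly (degree p) (q mod p)"]
    by (simp add: gf_trace_def tr_poly_mod)
qed

section \<open>Kerdock matrices as trace forms\<close>

lemma kerdock_P_carrier: "kerdock_P p z \<in> carrier_mat (degree p) (degree p)"
  by (rule carrier_matI) (simp_all add: kerdock_P_def gf_mat_def trace_mat_def)

text \<open>Moving \<open>gf_mat\<close> to the left argument turns \<open>x\<close> into the field
  product of \<open>x\<close> and \<open>z\<close>; then \<open>trace_mat\<close> yields the trace
  of xzy. Symmetry and injectivity of the Kerdock matrices are read off from this
  expression.\<close>

lemma kerdock_P_form:
  assumes p: "degree p > 0" and x: "x \<in> carrier_vec (degree p)" and y: "y \<in> carrier_vec (degree p)"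
  shows "x \<bullet> (kerdock_P p z *\<^sub>v y) = coeff (tr_poly p (poly_of_row x * poly_of_row z * poly_of_row y)) 0"
proof -
  have A: "gf_mat p z \<in> carrier_mat (degree p) (degree p)"
    and W: "trace_mat p \<in> carrier_mat (degree p) (degree p)"
    by (auto simp: gf_mat_def trace_mat_def intro: carrier_matI)
  have g: "gf_mult p x z \<in> carrier_vec (degree p)" by (simp add: gf_mult_def row_of_poly_def)
  have "x \<bullet> (kerdock_P p z *\<^sub>v y) = x \<bullet> (gf_mat p z *\<^sub>v (trace_mat p *\<^sub>v y))"
    using A W y by (simp add: kerdock_P_def assoc_mult_mat_vec)
  also have "\<dots> = ((gf_mat p z)\<^sup>T *\<^sub>v x) \<bullet> (trace_mat p *\<^sub>v y)"
    using transpose_vec_mult_scalar[OF A _ x, of "trace_mat p *\<^sub>v y"] W y by auto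
  also have "\<dots> = gf_mult p x z \<bullet> (trace_mat p *\<^sub>v y)" by (simp add: gf_mult_mat[OF x])
  also have "\<dots> = gf_trace p (gf_mult p (gf_mult p x z) y)"
    using gf_trace_mult[OF p g y] by simp
  also have "\<dots> = coeff (tr_poly p (poly_of_row (gf_mult p x z) * poly_of_row y)) 0"
    by (simp add: gf_trace_def tr_poly_gf_mult[OF p])
  also have "poly_of_row (gf_mult p x z) = (poly_of_row x * poly_of_row z) mod p"
    using p degree_mod_less[of p "poly_of_row x * poly_of_row z"] unfolding gf_mult_def
    by (intro poly_of_row_of_poly) (cases "p = 0"; auto)
  also have "tr_poly p ((poly_of_row x * poly_of_row z) mod p * poly_of_row y)
      = tr_poly p (poly_of_row x * poly_of_row z * poly_of_row y)"
    by (metis mod_mult_left_eq tr_poly_mod)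
  finally show ?thesis .
qed

lemma kerdock_P_symmetric:
  assumes p: "degree p > 0" and i: "i < degree p" and j: "j < degree p"
  shows "kerdock_P p z $$ (i, j) = kerdock_P p z $$ (j, i)"
proof -
  have "unit_vec (degree p) i \<bullet> (kerdock_P p z *\<^sub>v unit_vec (degree p) j) = kerdock_P p z $$ (i, j)"
    if "i < degree p" "j < degree p" for i j
    using that kerdock_P_carrier[of p z] by (auto simp: scalar_prod_left_unit)
  thus ?thesis using kerdock_P_form[OF p, of "unit_vec (degree p) i" "unit_vec (degree p) j" z]
      kerdock_P_form[OF p, of "unit_vec (degree p) j" "unit_vec (degree p) i" z] i j
    by (simp add: mult_ac)
qed

text \<open>Equality would make the trace of x(z - w)a vanish for every x, although (z - w)a is
  nonzero in the field. This nonsingularity of differences makes vectors of distinct Kerdock bases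
  nonorthogonal and supplies, for \<open>a\<close> nonzero, a Kerdock matrix sending
  \<open>a\<close> to a prescribed vector.\<close>

lemma kerdock_P_inj:
  assumes p: "primitive_irred p" and V: "z \<in> carrier_vec (degree p)" "w \<in> carrier_vec (degree p)"
      "a \<in> carrier_vec (degree p)"
    and zw: "z \<noteq> w" and a: "a \<noteq> 0\<^sub>v (degree p)"
  shows "kerdock_P p z *\<^sub>v a \<noteq> kerdock_P p w *\<^sub>v a"
proof
  let ?f = poly_of_row
  assume e: "kerdock_P p z *\<^sub>v a = kerdock_P p w *\<^sub>v a"
  have irr: "irreducible p" using p by (simp add: primitive_irred_def)
  have pd: "degree p > 0" using irr by (rule irreducible_degree_pos)
  have p0: "p \<noteq> 0" using pd by auto
  have pe: "prime_elem p" using irr by (rule field_poly_irreducible_imp_prime)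
  have dg: "degree (?f u) < degree p" if "u \<in> carrier_vec (degree p)" for u
    using pd that by (intro le_less_trans[OF degree_le[of "degree p - 1"]]) (auto simp: coeff_poly_of_row)
  have inj: "u = v" if "?f u = ?f v" "u \<in> carrier_vec (degree p)" "v \<in> carrier_vec (degree p)" for u v
    using that by (intro eq_vecI) (metis coeff_poly_of_row carrier_vecD, simp)
  have nz: "\<not> p dvd q" if "q \<noteq> 0" "degree q < degree p" for q
    using that dvd_imp_degree_le[of p q] by auto
  have "\<not> p dvd ?f z - ?f w"
    using inj[OF _ V(1,2)] zw dg[OF V(1)] dg[OF V(2)] by (intro nz) (auto intro: degree_diff_less)
  moreover have "?f (0\<^sub>v (degree p)) = 0" by (rule poly_eqI) (simp add: coeff_poly_of_row)
  hence "\<not> p dvd ?f a"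
    using inj[of a "0\<^sub>v (degree p)"] a V(3) dg[OF V(3)] by (intro nz) auto
  ultimately have "\<not> p dvd (?f z - ?f w) * ?f a" using pe prime_elem_dvd_mult_iff by blast
  then obtain q where q: "tr_poly p ((?f z - ?f w) * ?f a * q) \<noteq> 0"
    using tr_poly_nondegenerate[OF p] by blast
  \<comment> \<open>The witness \<open>q\<close> is an arbitrary polynomial; only its residue
    matters, and as a row it fits the bilinear form.\<close>
  define x where "x = row_of_poly (degree p) (q mod p)"
  have x: "x \<in> carrier_vec (degree p)" by (simp add: x_def row_of_poly_def)
  have fx: "?f x = q mod p" unfolding x_def using degree_mod_less[OF p0, of q]
    by (intro poly_of_row_of_poly) auto
  have m: "tr_poly p (?f x * r) = tr_poly p (q * r)" for r
    unfolding fx by (metis mod_mult_left_eq tr_poly_mod)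
  \<comment> \<open>The two-term case of \<open>tr_poly_sum\<close>; over GF(2) subtraction is
    addition.\<close>
  have add: "tr_poly p (r - s) = tr_poly p r - tr_poly p s" for r s
  proof -
    have "tr_poly p (\<Sum>i<2::nat. if i = 0 then r else s) = tr_poly p r + tr_poly p s"
      unfolding tr_poly_sum by (simp add: lessThan_nat_numeral)
    hence "tr_poly p (r + s) = tr_poly p r + tr_poly p s"
      by (simp add: lessThan_nat_numeral add.commute)
    moreover have minus: "u - v = u + v" for u v :: "bit poly" by (rule poly_eqI) simp
    ultimately show ?thesis unfolding minus by simp
  qed
  have "coeff (tr_poly p (?f x * ?f z * ?f a)) 0 = coeff (tr_poly p (?f x * ?f w * ?f a)) 0"
    using e kerdock_P_form[OF pd x V(3)] by metis
  hence "tr_poly p (?f x * (?f z * ?f a)) = tr_poly p (?f x * (?f w * ?f a))"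
    using tr_poly_const[OF irr] by (metis mult.assoc)
  hence "tr_poly p (q * (?f z * ?f a) - q * (?f w * ?f a)) = 0"
    by (simp add: m add)
  thus False using q by (simp add: algebra_simps)
qed

section \<open>Characters and functions on binary vectors\<close>

declare add_bit_eq_xor [simp del] mult_bit_eq_and [simp del] minus_bit_def [simp del]
  uminus_bit_def [simp del] power_bit_unfold [simp del]

lemma bit_add_self [simp]: "(b :: bit) + b = 0"
  by (cases b) auto

lemma bit_vec_add_self:
  fixes x :: "bit vec"
  assumes "x \<in> carrier_vec m"
  shows "x + x = 0\<^sub>v m"
  using assms by (intro eq_vecI) auto

lemma bit_vec_add_cancel:
  fixes x a :: "bit vec"
  assumes "x \<in> carrier_vec m" "a \<in> carrier_vec m"
  shows "x + a + a = x" "a + (a + x) = x" "a + (x + a) = x" "x + (a + a) = x"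
proof -
  have "c + d + d = c" "d + (d + c) = c" "d + (c + d) = c" "c + (d + d) = c" for c d :: bit
    by (cases c; cases d; auto)+
  with assms show "x + a + a = x" "a + (a + x) = x" "a + (x + a) = x" "x + (a + a) = x"
    by (auto intro!: eq_vecI)
qed

lemma of_nat_bit: "(of_nat k :: bit) = of_bool (odd k)"
  by (induction k) auto

lemma bin_label_carrier [simp]: "bin_label m k \<in> carrier_vec m"
  by (simp add: bin_label_def)

text \<open>Coordinate \<open>m - 1 - n\<close> of a label is bit \<open>n\<close> of the position,
  so equal labels mean equal bits below \<open>m\<close>. A preimage is the Horner sum of the
  coordinates read from the last to the first.\<close>

lemma bij_bin_label: "bij_betw (bin_label m) {..<2 ^ m} (carrier_vec m)"
  unfolding bij_betw_def
proof (intro conjI inj_onI equalityI subsetI)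
  fix k l :: nat
  assume kl: "k \<in> {..<2 ^ m}" "l \<in> {..<2 ^ m}" and e: "bin_label m k = bin_label m l"
  have "take_bit m k = take_bit m l"
  proof (rule bit_eqI)
    fix n
    have "bit k n = bit l n" if "n < m"
    proof -
      have "bin_label m k $ (m - 1 - n) = bin_label m l $ (m - 1 - n)" by (simp add: e)
      thus ?thesis using that by (auto simp: bin_label_def of_nat_bit bit_iff_odd of_bool_eq_iff)
    qed
    thus "bit (take_bit m k) n = bit (take_bit m l) n" by (auto simp: bit_take_bit_iff)
  qed
  thus "k = l" using kl by (simp add: take_bit_nat_eq_self)
next
  fix x :: "bit vec" assume x: "x \<in> carrier_vec m"
  let ?bs = "map (\<lambda>i. x $ (m - 1 - i) = 1) [0..<m]"
  let ?k = "horner_sum of_bool 2 ?bs :: nat"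
  have "?k < 2 ^ m" using horner_sum_of_bool_2_less[of ?bs] by simp
  moreover have "bin_label m ?k = x"
  proof (rule eq_vecI)
    fix i assume "i < dim_vec x"
    hence i: "i < m" using x by simp
    have "odd (?k div 2 ^ (m - 1 - i)) \<longleftrightarrow> x $ i = 1"
      using i by (simp add: bit_horner_sum_bit_iff bit_iff_odd[symmetric])
    thus "bin_label m ?k $ i = x $ i" using i by (cases "x $ i") (auto simp: bin_label_def of_nat_bit)
  qed (use x in \<open>simp add: bin_label_def\<close>)
  ultimately show "x \<in> bin_label m ` {..<2 ^ m}" by (metis imageI lessThan_iff)
qed auto

lemma finite_bit_vecs [simp]: "finite (carrier_vec m :: bit vec set)"
  using bij_betw_finite[OF bij_bin_label[of m]] by simp

lemma card_bit_vecs: "card (carrier_vec m :: bit vec set) = 2 ^ m"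
  using bij_betw_same_card[OF bij_bin_label[of m]] by simp

lemma sum_bin_label: "(\<Sum>k<2 ^ m. f (bin_label m k)) = (\<Sum>x\<in>carrier_vec m. f x)"
  by (rule sum.reindex_bij_betw[OF bij_bin_label])

text \<open>Coordinate vectors are written as functions on binary vectors, so that sums over
  positions become sums over the group \<open>carrier_vec m\<close>, where translations can be
  substituted.\<close>

definition label_vec :: "nat \<Rightarrow> (bit vec \<Rightarrow> complex) \<Rightarrow> complex vec" where
  "label_vec m f = vec (2 ^ m) (\<lambda>k. f (bin_label m k))"

lemma label_vec_carrier [simp]: "label_vec m f \<in> carrier_vec (2 ^ m)"
  by (simp add: label_vec_def)

lemma label_vec_eq_iff: "label_vec m f = label_vec m g \<longleftrightarrow> (\<forall>x\<in>carrier_vec m. f x = g x)"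
proof
  assume e: "label_vec m f = label_vec m g"
  show "\<forall>x\<in>carrier_vec m. f x = g x"
  proof
    fix x :: "bit vec" assume "x \<in> carrier_vec m"
    then obtain k where k: "k < 2 ^ m" "x = bin_label m k"
      using bij_betw_imp_surj_on[OF bij_bin_label[of m]] by blast
    have "label_vec m f $ k = label_vec m g $ k" by (simp add: e)
    thus "f x = g x" using k by (simp add: label_vec_def)
  qed
qed (auto simp: label_vec_def intro: eq_vecI)

lemma smult_label_vec: "c \<cdot>\<^sub>v label_vec m f = label_vec m (\<lambda>x. c * f x)"
  by (auto simp: label_vec_def)

lemma cscalar_prod_label_vec:
  "label_vec m f \<bullet>c label_vec m g = (\<Sum>x\<in>carrier_vec m. f x * cnj (g x))"
  by (simp add: label_vec_def scalar_prod_def lessThan_atLeast0[symmetric]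
      sum_bin_label[of "\<lambda>x. f x * cnj (g x)", symmetric])

text \<open>The nontrivial additive character of GF(2).\<close>

definition bit_sign :: "bit \<Rightarrow> complex" where
  "bit_sign b = (- 1) ^ bit_nat b"

lemma bit_sign_simps [simp]: "bit_sign 0 = 1" "bit_sign 1 = - 1"
  by (simp_all add: bit_sign_def bit_nat_def)

lemma bit_sign_add: "bit_sign (a + b) = bit_sign a * bit_sign b"
  by (cases a; cases b) auto

lemma bit_sign_sum: "bit_sign (\<Sum>i\<in>S. f i) = (\<Prod>i\<in>S. bit_sign (f i))"
  by (induction S rule: infinite_finite_induct) (auto simp: bit_sign_add)

lemma bit_sign_of_nat: "bit_sign (of_nat n) = (- 1) ^ n"
  by (auto simp: of_nat_bit)

lemma cnj_bit_sign [simp]: "cnj (bit_sign b) = bit_sign b"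
  by (cases b) auto

lemma bit_sign_square [simp]: "bit_sign b * bit_sign b = 1" "bit_sign b * (bit_sign b * c) = c"
  by (cases b; simp)+

lemma bit_sign_nonzero [simp]: "bit_sign b \<noteq> 0"
  by (cases b) auto

lemma translate_bit_vecs:
  assumes "a \<in> carrier_vec m"
  shows "bij_betw (\<lambda>x. x + a) (carrier_vec m) (carrier_vec m :: bit vec set)"
  by (rule bij_betw_byWitness[where f' = "\<lambda>x. x + a"])
    (use assms in \<open>auto simp: bit_vec_add_cancel\<close>)

text \<open>Adding the unit vector of a coordinate where \<open>b\<close> is nonzero permutes the
  summands and flips every sign, so the sum equals its own negative.\<close>

lemma sum_bit_sign:
  assumes b: "b \<in> carrier_vec m" and nz: "b \<noteq> 0\<^sub>v m"
  shows "(\<Sum>x\<in>carrier_vec m. bit_sign (x \<bullet> b)) = 0"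
proof -
  have "\<exists>i<m. b $ i \<noteq> 0"
  proof (rule ccontr)
    assume "\<not> (\<exists>i<m. b $ i \<noteq> 0)"
    hence "b = 0\<^sub>v m" using b by (intro eq_vecI) auto
    thus False using nz by simp
  qed
  then obtain i where i: "i < m" "b $ i = 1" by auto
  let ?e = "unit_vec m i"
  have "(\<Sum>x\<in>carrier_vec m. bit_sign (x \<bullet> b)) = (\<Sum>x\<in>carrier_vec m. bit_sign ((x + ?e) \<bullet> b))"
    by (rule sum.reindex_bij_betw[OF translate_bit_vecs, symmetric]) simp
  also have "\<dots> = (\<Sum>x\<in>carrier_vec m. - bit_sign (x \<bullet> b))"
  proof (rule sum.cong[OF refl])
    fix x :: "bit vec" assume x: "x \<in> carrier_vec m"
    have "(x + ?e) \<bullet> b = x \<bullet> b + 1"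
      using x b i by (simp add: add_scalar_prod_distrib[of _ m] scalar_prod_left_unit)
    thus "bit_sign ((x + ?e) \<bullet> b) = - bit_sign (x \<bullet> b)" by (simp add: bit_sign_add)
  qed
  finally show ?thesis by (simp add: sum_negf)
qed

text \<open>The fourth roots of unity serve both as the entries of the diagonal factor of a symmetry
  and as the scalars of the Heisenberg-Weyl group.\<close>

definition phases :: "complex set" where
  "phases = {1, \<i>, - 1, - \<i>}"

lemma phases_iff_power: "c \<in> phases \<longleftrightarrow> (\<exists>k<4. c = \<i> ^ k)"
proof -
  have "{..<4} = {0, 1, 2, 3 :: nat}" by auto
  hence "(\<exists>k<4. c = \<i> ^ k) \<longleftrightarrow> (\<exists>k\<in>{0, 1, 2, 3}. c = \<i> ^ k)" by blast
  also have "\<dots> \<longleftrightarrow> c \<in> phases" by (simp add: phases_def power3_eq_cube)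
  finally show ?thesis ..
qed

lemma phases_mult: "c \<in> phases \<Longrightarrow> d \<in> phases \<Longrightarrow> c * d \<in> phases"
  by (auto simp: phases_def)

lemma phases_one [simp]: "1 \<in> phases"
  by (simp add: phases_def)

lemma phases_power: "c \<in> phases \<Longrightarrow> c ^ n \<in> phases"
  by (induction n) (auto intro: phases_mult)

lemma phases_i_power [simp]: "\<i> ^ n \<in> phases"
  by (rule phases_power) (simp add: phases_def)

lemma phases_bit_sign [simp]: "bit_sign b \<in> phases"
  by (cases b) (auto simp: phases_def)

lemma phases_cnj: "c \<in> phases \<Longrightarrow> cnj c \<in> phases"
  by (auto simp: phases_def)

lemma phases_cnj_mult: "c \<in> phases \<Longrightarrow> cnj c * c = 1" "c \<in> phases \<Longrightarrow> c * cnj c = 1"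
  by (auto simp: phases_def)

lemma phases_nonzero: "c \<in> phases \<Longrightarrow> c \<noteq> 0"
  by (auto simp: phases_def)

section \<open>Pauli matrices\<close>

text \<open>Each factor sees one binary digit of the row and column positions, the first factor the
  most significant one. Splitting off that factor divides the positions by \<open>2 ^ m\<close>: the
  quotient is the top digit, the remainder holds the others.\<close>

lemma foldr_kronecker_index:
  assumes "\<And>i. i < m \<Longrightarrow> A i \<in> carrier_mat 2 2"
  shows "foldr kronecker (map A [0..<m]) (1\<^sub>m 1) = mat (2 ^ m) (2 ^ m)
    (\<lambda>(k, l). \<Prod>i<m. A i $$ (k div 2 ^ (m - 1 - i) mod 2, l div 2 ^ (m - 1 - i) mod 2))"
  using assms
proof (induction m arbitrary: A)
  case 0
  show ?case by (rule eq_matI) auto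
next
  case (Suc m)
  let ?M = "mat (2 ^ m) (2 ^ m)
    (\<lambda>(k, l). \<Prod>i<m. A (Suc i) $$ (k div 2 ^ (m - 1 - i) mod 2, l div 2 ^ (m - 1 - i) mod 2))"
  have "foldr kronecker (map A [0..<Suc m]) (1\<^sub>m 1)
      = kronecker (A 0) (foldr kronecker (map (\<lambda>i. A (Suc i)) [0..<m]) (1\<^sub>m 1))"
    by (simp add: upt_conv_Cons map_Suc_upt[symmetric] o_def del: upt_Suc)
  also have "\<dots> = kronecker (A 0) ?M"
    using Suc.prems by (subst Suc.IH) auto
  also have "\<dots> = mat (2 ^ Suc m) (2 ^ Suc m)
    (\<lambda>(k, l). \<Prod>i<Suc m. A i $$ (k div 2 ^ (Suc m - 1 - i) mod 2, l div 2 ^ (Suc m - 1 - i) mod 2))"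
    (is "_ = ?R")
  proof (rule eq_matI)
    fix k l assume kl: "k < dim_row ?R" "l < dim_col ?R"
    have low: "n mod 2 ^ m div 2 ^ (m - 1 - i) mod 2 = n div 2 ^ (m - Suc i) mod 2" if "i < m" for n i :: nat
    proof -
      have "bit (n mod 2 ^ m) (m - 1 - i) = bit n (m - 1 - i)"
        using that by (simp add: take_bit_eq_mod[symmetric] bit_take_bit_iff)
      thus ?thesis by (simp add: bit_iff_odd mod_2_eq_odd)
    qed
    have high: "n div 2 ^ m mod 2 = n div 2 ^ m" if "n < 2 ^ Suc m" for n :: nat
      using that by (simp add: less_mult_imp_div_less)
    show "kronecker (A 0) ?M $$ (k, l) = ?R $$ (k, l)"
      using kl Suc.prems[of 0] low high
      by (auto simp: kronecker_def prod.lessThan_Suc_shift simp del: prod.lessThan_Suc)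
  qed (use Suc.prems[of 0] in \<open>auto simp: kronecker_def\<close>)
  finally show ?case .
qed

lemma pauli_X_carrier [simp]: "pauli_X \<in> carrier_mat 2 2"
  by (rule carrier_matI) (simp_all add: pauli_X_def mat_of_rows_list_def)

lemma pauli_Z_carrier [simp]: "pauli_Z \<in> carrier_mat 2 2"
  by (rule carrier_matI) (simp_all add: pauli_Z_def mat_of_rows_list_def)

lemma pauli_factor_carrier: "(pauli_X ^\<^sub>m bit_nat a) * (pauli_Z ^\<^sub>m bit_nat b) \<in> carrier_mat 2 2"
  by (intro mult_carrier_mat[of _ 2 2] pow_carrier_mat) simp_all

lemma pauli_factor_index:
  assumes "s < 2" "t < 2"
  shows "((pauli_X ^\<^sub>m bit_nat a) * (pauli_Z ^\<^sub>m bit_nat b)) $$ (s, t)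
    = (if (of_nat s :: bit) = of_nat t + a then bit_sign (b * of_nat t) else 0)"
proof -
  have X: "pauli_X ^\<^sub>m bit_nat a = mat 2 2 (\<lambda>(i, j). of_bool (i = j \<longleftrightarrow> a = 0))"
    by (rule eq_matI) (cases a; auto simp: bit_nat_def pauli_X_def mat_of_rows_list_def less_2_cases_iff)+
  have Z: "pauli_Z ^\<^sub>m bit_nat b = mat 2 2 (\<lambda>(i, j). of_bool (i = j) * bit_sign (b * of_nat j))"
    by (rule eq_matI) (cases b; auto simp: bit_nat_def pauli_Z_def mat_of_rows_list_def less_2_cases_iff)+
  have I: "{0..<2} = {0, 1 :: nat}" by auto
  have "s = 0 \<or> s = 1" "t = 0 \<or> t = 1" using assms by auto
  thus ?thesis unfolding X Z by (elim disjE; cases a; simp add: scalar_prod_def I)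
qed

text \<open>The product over the digits survives only if every digit of the row is that of the
  column shifted by \<open>a\<close>; the signs multiply to the character of \<open>b\<close>. The
  matrix is thus a translation combined with a sign.\<close>

lemma pauli_D_index:
  assumes a: "a \<in> carrier_vec m" and b: "b \<in> carrier_vec m" and k: "k < 2 ^ m" and l: "l < 2 ^ m"
  shows "pauli_D m a b $$ (k, l) =
    (if bin_label m k = bin_label m l + a then bit_sign (b \<bullet> bin_label m l) else 0)"
proof -
  let ?x = "bin_label m k" and ?y = "bin_label m l"
  have bl: "of_nat (n div 2 ^ (m - Suc i) mod 2) = bin_label m n $ i" if "i < m" for n i
    using that by (auto simp: bin_label_def of_nat_bit odd_iff_mod_2_eq_one)
  have "pauli_D m a b $$ (k, l) = (\<Prod>i<m. if ?x $ i = ?y $ i + a $ i then bit_sign (b $ i * ?y $ i) else 0)"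
    unfolding pauli_D_def using k l
    by (subst foldr_kronecker_index) (auto simp: pauli_factor_carrier pauli_factor_index bl intro!: prod.cong)
  also have "\<dots> = (if \<forall>i<m. ?x $ i = ?y $ i + a $ i then \<Prod>i<m. bit_sign (b $ i * ?y $ i) else 0)"
    by (auto intro!: prod.cong prod_zero)
  also have "(\<Prod>i<m. bit_sign (b $ i * ?y $ i)) = bit_sign (b \<bullet> ?y)"
    using b by (simp add: scalar_prod_def bit_sign_sum lessThan_atLeast0 bin_label_def)
  also have "(\<forall>i<m. ?x $ i = ?y $ i + a $ i) \<longleftrightarrow> ?x = ?y + a"
  proof
    assume "\<forall>i<m. ?x $ i = ?y $ i + a $ i"
    thus "?x = ?y + a" using a by (intro eq_vecI) (auto simp: bin_label_def)
  next
    assume "?x = ?y + a"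
    thus "\<forall>i<m. ?x $ i = ?y $ i + a $ i" using a by (metis carrier_vecD index_add_vec(1))
  qed
  finally show ?thesis .
qed

lemma pauli_D_carrier [simp]: "pauli_D m a b \<in> carrier_mat (2 ^ m) (2 ^ m)"
  unfolding pauli_D_def by (subst foldr_kronecker_index) (auto simp: pauli_factor_carrier)

lemma pauli_D_mult_label_vec:
  assumes a: "a \<in> carrier_vec m" and b: "b \<in> carrier_vec m"
  shows "pauli_D m a b *\<^sub>v label_vec m f = label_vec m (\<lambda>x. bit_sign (b \<bullet> (x + a)) * f (x + a))"
proof (rule eq_vecI)
  fix k assume "k < dim_vec (label_vec m (\<lambda>x. bit_sign (b \<bullet> (x + a)) * f (x + a)))"
  hence k: "k < 2 ^ m" by (simp add: label_vec_def)
  let ?x = "bin_label m k"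
  \<comment> \<open>In characteristic 2 the row condition solves for \<open>y\<close>, so a single
    summand survives.\<close>
  have eq: "?x = y + a \<longleftrightarrow> y = ?x + a" if "y \<in> carrier_vec m" for y
    using that a bit_vec_add_cancel(1)[of _ m a] bin_label_carrier by metis
  have "dim_row (pauli_D m a b) = 2 ^ m" "dim_col (pauli_D m a b) = 2 ^ m"
    by (rule carrier_matD[OF pauli_D_carrier])+
  hence "(pauli_D m a b *\<^sub>v label_vec m f) $ k
      = (\<Sum>l<2 ^ m. (if ?x = bin_label m l + a then bit_sign (b \<bullet> bin_label m l) else 0) * f (bin_label m l))"
    using k by (simp add: scalar_prod_def label_vec_def pauli_D_index[OF a b] lessThan_atLeast0)
  also have "\<dots> = (\<Sum>y\<in>carrier_vec m. (if ?x = y + a then bit_sign (b \<bullet> y) else 0) * f y)"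
    by (rule sum_bin_label)
  also have "\<dots> = (\<Sum>y\<in>carrier_vec m. if y = ?x + a then bit_sign (b \<bullet> y) * f y else 0)"
    by (rule sum.cong) (auto simp: eq)
  also have "\<dots> = bit_sign (b \<bullet> (?x + a)) * f (?x + a)" using a by (simp add: sum.delta')
  finally show "(pauli_D m a b *\<^sub>v label_vec m f) $ k
      = label_vec m (\<lambda>x. bit_sign (b \<bullet> (x + a)) * f (x + a)) $ k"
    using k by (simp add: label_vec_def)
qed (simp add: label_vec_def carrier_matD(1)[OF pauli_D_carrier])

section \<open>Quadratic forms modulo 4\<close>

text \<open>The congruence modulo 4 is witnessed in the integers because the correction
  \<open>t\<close> in the expansion of a quadratic form can be negative.\<close>

lemma i_power_cong:
  assumes "int a = int b + 4 * t"
  shows "\<i> ^ a = \<i> ^ b"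
proof -
  have r: "\<i> ^ n = \<i> ^ (n mod 4)" for n
  proof -
    have "\<i> ^ n = \<i> ^ (4 * (n div 4) + n mod 4)" by simp
    also have "\<dots> = (\<i> ^ 4) ^ (n div 4) * \<i> ^ (n mod 4)" by (simp only: power_add power_mult)
    finally show ?thesis by (simp add: power4_eq_xxxx)
  qed
  have "int a mod 4 = int b mod 4" using assms by simp
  hence "a mod 4 = b mod 4" by (metis of_nat_eq_iff of_nat_mod of_nat_numeral)
  thus ?thesis using r[of a] r[of b] by simp
qed

text \<open>The integer lift of a sum of bits is u + v - 2uv. In the expanded form, symmetry of
  \<open>P\<close> doubles the mixed terms: those containing the product uv become multiples of 4,
  and twice the form in x and y remains, which \<open>\<i>\<close> turns into a sign.\<close>

lemma i_power_quad_form_add: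
  assumes P: "P \<in> carrier_mat m m" and sym: "\<And>i j. i < m \<Longrightarrow> j < m \<Longrightarrow> P $$ (i, j) = P $$ (j, i)"
    and x: "x \<in> carrier_vec m" and y: "y \<in> carrier_vec m"
  shows "\<i> ^ int_quad_form P (x + y)
    = \<i> ^ int_quad_form P x * \<i> ^ int_quad_form P y * bit_sign (x \<bullet> (P *\<^sub>v y))"
proof -
  define B where "B u v = (\<Sum>i<m. \<Sum>j<m. u i * int (bit_nat (P $$ (i, j))) * v j)" for u v :: "nat \<Rightarrow> int"
  define k where "k = (\<Sum>i<m. \<Sum>j<m. bit_nat (x $ i) * bit_nat (P $$ (i, j)) * bit_nat (y $ j))"
  let ?u = "\<lambda>i. int (bit_nat (x $ i))" and ?v = "\<lambda>i. int (bit_nat (y $ i))"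
  let ?w = "\<lambda>i. ?u i * ?v i"
  have q: "int (int_quad_form P z) = B (\<lambda>i. int (bit_nat (z $ i))) (\<lambda>i. int (bit_nat (z $ i)))"
    if "z \<in> carrier_vec m" for z
    using that by (simp add: int_quad_form_def B_def)
  have add: "int (bit_nat (a + b)) = int (bit_nat a) + int (bit_nat b) - 2 * (int (bit_nat a) * int (bit_nat b))"
    for a b by (cases a; cases b) (auto simp: bit_nat_def)
  have Bs: "B v u = B u v" for u v
    unfolding B_def by (subst sum.swap) (auto intro!: sum.cong simp: sym mult_ac)
  have "int (int_quad_form P (x + y)) = B (\<lambda>i. ?u i + ?v i - 2 * ?w i) (\<lambda>i. ?u i + ?v i - 2 * ?w i)"
    using x y by (subst q) (auto simp: B_def add intro!: sum.cong)
  also have "\<dots> = B ?u ?u + B ?v ?v + B ?u ?v + B ?v ?u + 4 * B ?w ?w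
      - 2 * B ?u ?w - 2 * B ?w ?u - 2 * B ?v ?w - 2 * B ?w ?v"
    by (simp add: B_def algebra_simps sum.distrib sum_subtractf sum_distrib_left)
  also have "\<dots> = B ?u ?u + B ?v ?v + 2 * B ?u ?v + 4 * (B ?w ?w - B ?u ?w - B ?v ?w)"
    by (simp add: Bs[of ?v ?u] Bs[of ?w ?u] Bs[of ?w ?v])
  also have "B ?u ?v = int k" by (simp add: B_def k_def)
  finally have "int (int_quad_form P (x + y)) = int (int_quad_form P x + int_quad_form P y + 2 * k)
      + 4 * (B ?w ?w - B ?u ?w - B ?v ?w)"
    using x y by (simp add: q)
  hence "\<i> ^ int_quad_form P (x + y) = \<i> ^ (int_quad_form P x + int_quad_form P y + 2 * k)"
    by (rule i_power_cong)
  also have "\<dots> = \<i> ^ int_quad_form P x * \<i> ^ int_quad_form P y * bit_sign (of_nat k)"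
    by (simp add: power_add power_mult bit_sign_of_nat)
  also have "of_nat k = x \<bullet> (P *\<^sub>v y)"
  proof -
    have n: "of_nat (bit_nat b) = b" for b :: bit by (cases b) (auto simp: bit_nat_def)
    show ?thesis using P x y
      by (auto simp: k_def n scalar_prod_def lessThan_atLeast0 sum_distrib_left mult.assoc intro!: sum.cong)
  qed
  finally show ?thesis .
qed

lemma bit_sign_scalar_add:
  assumes "x \<in> carrier_vec m" "y \<in> carrier_vec m" "b \<in> carrier_vec m"
  shows "bit_sign ((x + y) \<bullet> b) = bit_sign (x \<bullet> b) * bit_sign (y \<bullet> b)"
    "bit_sign (b \<bullet> (x + y)) = bit_sign (b \<bullet> x) * bit_sign (b \<bullet> y)"
  using assms by (simp_all add: add_scalar_prod_distrib[of _ m] scalar_prod_add_distrib[of _ m] bit_sign_add)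

text \<open>The squared modulus of the sum is evaluated by substituting \<open>x + a\<close> for one of the two variables.\<close>

lemma quadratic_sum_nonzero:
  assumes unit: "\<And>x. x \<in> carrier_vec m \<Longrightarrow> g x * cnj (g x) = 1"
    and add: "\<And>x a. x \<in> carrier_vec m \<Longrightarrow> a \<in> carrier_vec m \<Longrightarrow> g (x + a) = g x * g a * bit_sign (x \<bullet> L a)"
    and L: "\<And>a. a \<in> carrier_vec m \<Longrightarrow> a \<noteq> 0\<^sub>v m \<Longrightarrow> L a \<in> carrier_vec m \<and> L a \<noteq> 0\<^sub>v m"
  shows "(\<Sum>x\<in>carrier_vec m. g x) \<noteq> 0"
proof
  let ?V = "carrier_vec m :: bit vec set"
  assume z: "(\<Sum>x\<in>?V. g x) = 0"
  have "0 = (\<Sum>x\<in>?V. cnj (g x) * (\<Sum>y\<in>?V. g y))" by (simp add: z)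
  also have "\<dots> = (\<Sum>x\<in>?V. cnj (g x) * (\<Sum>a\<in>?V. g (x + a)))"
  proof (rule sum.cong[OF refl])
    fix x assume x: "x \<in> ?V"
    have "(\<Sum>a\<in>?V. g (a + x)) = (\<Sum>y\<in>?V. g y)"
      by (rule sum.reindex_bij_betw[OF translate_bit_vecs[OF x]])
    also have "(\<Sum>a\<in>?V. g (a + x)) = (\<Sum>a\<in>?V. g (x + a))"
      using x by (intro sum.cong) (auto simp: comm_add_vec[of _ m])
    finally show "cnj (g x) * (\<Sum>y\<in>?V. g y) = cnj (g x) * (\<Sum>a\<in>?V. g (x + a))" by simp
  qed
  also have "\<dots> = (\<Sum>a\<in>?V. \<Sum>x\<in>?V. cnj (g x) * g (x + a))"
    unfolding sum_distrib_left by (rule sum.swap)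
  \<comment> \<open>For \<open>a = 0\<^sub>v m\<close> every term is 1; otherwise the phases of
    \<open>x\<close> cancel and a nontrivial character is summed.\<close>
  also have "\<dots> = (\<Sum>a\<in>?V. if a = 0\<^sub>v m then 2 ^ m else 0)"
  proof (rule sum.cong[OF refl])
    fix a assume a: "a \<in> ?V"
    show "(\<Sum>x\<in>?V. cnj (g x) * g (x + a)) = (if a = 0\<^sub>v m then 2 ^ m else 0)"
    proof (cases "a = 0\<^sub>v m")
      case True
      have "(\<Sum>x\<in>?V. cnj (g x) * g (x + a)) = (\<Sum>x\<in>?V. 1)"
        using unit True by (intro sum.cong) (auto simp: mult.commute)
      thus ?thesis using True by (simp add: card_bit_vecs)
    next
      case False
      have "(\<Sum>x\<in>?V. cnj (g x) * g (x + a)) = (\<Sum>x\<in>?V. g a * bit_sign (x \<bullet> L a))"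
      proof (rule sum.cong[OF refl])
        fix x assume x: "x \<in> ?V"
        have "cnj (g x) * g (x + a) = (g x * cnj (g x)) * (g a * bit_sign (x \<bullet> L a))"
          by (simp add: add[OF x a] mult_ac)
        thus "cnj (g x) * g (x + a) = g a * bit_sign (x \<bullet> L a)" by (simp add: unit[OF x])
      qed
      also have "\<dots> = 0"
        using L[OF a False] by (simp add: sum_bit_sign flip: sum_distrib_left)
      finally show ?thesis using False by simp
    qed
  qed
  also have "\<dots> = 2 ^ m" by (simp add: sum.delta')
  finally show False by simp
qed

lemma ex_label_vec:
  assumes "v \<in> carrier_vec (2 ^ m)"
  shows "\<exists>f. v = label_vec m f"
proof
  have "inv_into {..<2 ^ m} (bin_label m) (bin_label m k) = k" if "k < 2 ^ m" for k
    using that bij_bin_label[of m] by (intro inv_into_f_f) (auto simp: bij_betw_def)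
  thus "v = label_vec m (\<lambda>x. v $ inv_into {..<2 ^ m} (bin_label m) x)"
    using assms by (intro eq_vecI) (auto simp: label_vec_def)
qed

lemma scalar_prod_label_vec:
  "label_vec m f \<bullet> label_vec m g = (\<Sum>x\<in>carrier_vec m. f x * g x)"
  by (simp add: label_vec_def scalar_prod_def lessThan_atLeast0[symmetric]
      sum_bin_label[of "\<lambda>x. f x * g x", symmetric])

lemma pauli_D_isometry:
  assumes ab: "a \<in> carrier_vec m" "b \<in> carrier_vec m"
    and v: "v \<in> carrier_vec (2 ^ m)" and w: "w \<in> carrier_vec (2 ^ m)"
  shows "(pauli_D m a b *\<^sub>v v) \<bullet>c (pauli_D m a b *\<^sub>v w) = v \<bullet>c w"
proof -
  obtain f g where fg: "v = label_vec m f" "w = label_vec m g"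
    using ex_label_vec[OF v] ex_label_vec[OF w] by blast
  have "(pauli_D m a b *\<^sub>v v) \<bullet>c (pauli_D m a b *\<^sub>v w) = (\<Sum>x\<in>carrier_vec m. f (x + a) * cnj (g (x + a)))"
    unfolding fg pauli_D_mult_label_vec[OF ab] cscalar_prod_label_vec
    by (intro sum.cong) (auto simp: mult_ac)
  also have "\<dots> = (\<Sum>x\<in>carrier_vec m. f x * cnj (g x))"
    by (rule sum.reindex_bij_betw[OF translate_bit_vecs[OF ab(1)]])
  finally show ?thesis by (simp add: fg cscalar_prod_label_vec)
qed

section \<open>The Kerdock bases\<close>

locale kerdock =
  fixes p :: "bit poly" and m :: nat
  assumes deg: "degree p = m" and prim: "primitive_irred p"
begin

abbreviation V :: "bit vec set" where "V \<equiv> carrier_vec m"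

lemma m_pos: "m > 0"
  using irreducible_degree_pos[of p] prim deg by (simp add: primitive_irred_def)

lemma P_carrier [simp]: "kerdock_P p z \<in> carrier_mat m m"
  using kerdock_P_carrier[of p z] by (simp add: deg)

lemma P_dim: "dim_row (kerdock_P p z) = m" "dim_col (kerdock_P p z) = m"
  by (rule carrier_matD[OF P_carrier])+

lemma P_mult_carrier [simp]: "a \<in> V \<Longrightarrow> kerdock_P p z *\<^sub>v a \<in> V"
  by (rule mult_mat_vec_carrier[OF P_carrier])

lemma P_zero [simp]: "kerdock_P p z *\<^sub>v 0\<^sub>v m = 0\<^sub>v m"
  by (rule eq_vecI) (simp_all add: scalar_prod_def P_dim)

lemma P_inj:
  "z \<in> V \<Longrightarrow> w \<in> V \<Longrightarrow> a \<in> V \<Longrightarrow> z \<noteq> w \<Longrightarrow> a \<noteq> 0\<^sub>v m \<Longrightarrow> kerdock_P p z *\<^sub>v a \<noteq> kerdock_P p w *\<^sub>v a"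
  using kerdock_P_inj[OF prim, of z w a] by (simp add: deg)

text \<open>An injective map of a finite set to itself is onto. This finds the Kerdock basis in
  which a Pauli matrix with nonzero \<open>a\<close> is diagonal.\<close>

lemma P_surj:
  assumes a: "a \<in> V" "a \<noteq> 0\<^sub>v m" and b: "b \<in> V"
  shows "\<exists>z\<in>V. kerdock_P p z *\<^sub>v a = b"
proof -
  have "inj_on (\<lambda>z. kerdock_P p z *\<^sub>v a) V" using P_inj a by (meson inj_onI)
  hence "(\<lambda>z. kerdock_P p z *\<^sub>v a) ` V = V" using a by (intro endo_inj_surj) auto
  thus ?thesis using b by (metis (no_types, lifting) image_iff)
qed

definition qphase :: "bit vec \<Rightarrow> bit vec \<Rightarrow> complex" where
  "qphase z x = \<i> ^ int_quad_form (kerdock_P p z) x"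

lemma qphase_add:
  assumes "x \<in> V" "y \<in> V"
  shows "qphase z (x + y) = qphase z x * qphase z y * bit_sign (x \<bullet> (kerdock_P p z *\<^sub>v y))"
  unfolding qphase_def
  by (rule i_power_quad_form_add[OF P_carrier _ assms])
    (use kerdock_P_symmetric[of p] in \<open>simp add: deg m_pos\<close>)

lemma qphase_phase [simp]: "qphase z x \<in> phases"
  by (simp add: qphase_def)

lemma qphase_cnj [simp]: "qphase z x * cnj (qphase z x) = 1" "cnj (qphase z x) * qphase z x = 1"
  by (simp_all add: phases_cnj_mult)

text \<open>The entries of column \<open>y\<close> of each block; \<open>None\<close> stands for the
  index \<infinity> of the standard basis.\<close>

fun basis_fun :: "bit vec option \<Rightarrow> bit vec \<Rightarrow> bit vec \<Rightarrow> complex" where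
  "basis_fun None y x = of_bool (x = y)"
| "basis_fun (Some z) y x = qphase z x * bit_sign (x \<bullet> y) / complex_of_real (sqrt (2 ^ m))"

abbreviation indices :: "bit vec option set" where
  "indices \<equiv> insert None (Some ` V)"

abbreviation bvec :: "bit vec option \<Rightarrow> bit vec \<Rightarrow> complex vec" where
  "bvec t y \<equiv> label_vec m (basis_fun t y)"

definition lines :: "bit vec option \<Rightarrow> complex vec set" where
  "lines t = {c \<cdot>\<^sub>v bvec t y | c y. c \<in> phases \<and> y \<in> V}"

lemma sqrt_square: "complex_of_real (sqrt (2 ^ m)) * complex_of_real (sqrt (2 ^ m)) = 2 ^ m"
  by (simp flip: of_real_mult)

lemma sum_bit_sign_delta:
  assumes "x \<in> V" "y \<in> V"
  shows "(\<Sum>u\<in>V. bit_sign (u \<bullet> (x + y))) = (if x = y then 2 ^ m else 0)"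
proof (cases "x = y")
  case True
  thus ?thesis using assms by (simp add: bit_vec_add_self card_bit_vecs)
next
  case False
  have "x + y \<noteq> 0\<^sub>v m"
  proof
    assume "x + y = 0\<^sub>v m"
    hence "x + y + y = y" using assms by simp
    thus False using False assms by (simp add: bit_vec_add_cancel)
  qed
  thus ?thesis using assms False by (simp add: sum_bit_sign)
qed

lemma basis_orthonormal:
  assumes "y \<in> V" "y' \<in> V"
  shows "bvec t y \<bullet>c bvec t y' = of_bool (y = y')"
proof (cases t)
  case None
  have "bvec t y \<bullet>c bvec t y' = (\<Sum>x\<in>V. if x = y then of_bool (y = y') else 0)"
    unfolding cscalar_prod_label_vec None by (intro sum.cong) auto
  thus ?thesis using assms by (simp add: sum.delta')
next
  case (Some z)
  have "bvec t y \<bullet>c bvec t y' = (\<Sum>x\<in>V. bit_sign (x \<bullet> (y + y')) / 2 ^ m)"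
    unfolding cscalar_prod_label_vec Some
  proof (rule sum.cong[OF refl])
    fix x assume x: "x \<in> V"
    have "basis_fun (Some z) y x * cnj (basis_fun (Some z) y' x)
        = (qphase z x * cnj (qphase z x)) * (bit_sign (x \<bullet> y) * bit_sign (x \<bullet> y'))
          / (complex_of_real (sqrt (2 ^ m)) * complex_of_real (sqrt (2 ^ m)))"
      by (simp only: basis_fun.simps complex_cnj_mult complex_cnj_divide complex_cnj_complex_of_real
          cnj_bit_sign times_divide_times_eq mult_ac)
    thus "basis_fun (Some z) y x * cnj (basis_fun (Some z) y' x) = bit_sign (x \<bullet> (y + y')) / 2 ^ m"
      using assms x unfolding sqrt_square qphase_cnj by (simp add: bit_sign_scalar_add[of _ m])
  qed
  thus ?thesis using sum_bit_sign_delta[OF assms] by (simp flip: sum_divide_distrib)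
qed

text \<open>Completeness recovers a vector from its coefficients in a basis. The sum runs over the
  character label, so the quadratic phases of \<open>x\<close> and \<open>x'\<close> are constant
  factors and a character sum remains.\<close>

lemma basis_complete:
  assumes "x \<in> V" "x' \<in> V"
  shows "(\<Sum>y\<in>V. basis_fun t y x * cnj (basis_fun t y x')) = of_bool (x = x')"
proof (cases t)
  case None
  have "(\<Sum>y\<in>V. basis_fun t y x * cnj (basis_fun t y x')) = (\<Sum>y\<in>V. if y = x then of_bool (x = x') else 0)"
    unfolding None by (intro sum.cong) auto
  thus ?thesis using assms by (simp add: sum.delta')
next
  case (Some z)
  have "(\<Sum>y\<in>V. basis_fun t y x * cnj (basis_fun t y x'))
      = (\<Sum>y\<in>V. qphase z x * cnj (qphase z x') / 2 ^ m * bit_sign (y \<bullet> (x + x')))"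
    unfolding Some
  proof (rule sum.cong[OF refl])
    fix y assume y: "y \<in> V"
    have "basis_fun (Some z) y x * cnj (basis_fun (Some z) y x')
        = (qphase z x * cnj (qphase z x')) * (bit_sign (x \<bullet> y) * bit_sign (x' \<bullet> y))
          / (complex_of_real (sqrt (2 ^ m)) * complex_of_real (sqrt (2 ^ m)))"
      by (simp only: basis_fun.simps complex_cnj_mult complex_cnj_divide complex_cnj_complex_of_real
          cnj_bit_sign times_divide_times_eq mult_ac)
    also have "bit_sign (x \<bullet> y) * bit_sign (x' \<bullet> y) = bit_sign (y \<bullet> (x + x'))"
      using assms y by (simp add: bit_sign_scalar_add[of _ m] comm_scalar_prod[of y m])
    finally show "basis_fun (Some z) y x * cnj (basis_fun (Some z) y x')
        = qphase z x * cnj (qphase z x') / 2 ^ m * bit_sign (y \<bullet> (x + x'))"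
      unfolding sqrt_square by simp
  qed
  also have "\<dots> = qphase z x * cnj (qphase z x') / 2 ^ m * (\<Sum>y\<in>V. bit_sign (y \<bullet> (x + x')))"
    by (rule sum_distrib_left[symmetric])
  finally show ?thesis using sum_bit_sign_delta[OF assms] by auto
qed

lemma basis_fun_Some_nonzero: "basis_fun (Some z) y x \<noteq> 0"
  using phases_nonzero[OF qphase_phase] by simp

text \<open>Against the standard basis the inner product is a single entry, up to conjugation, and
  this is nonzero. For two Kerdock bases it is, up to the factor \<open>1 / 2 ^ m\<close>, a sum of
  quadratic phases whose polar form has the sum of the two Kerdock matrices; nonsingularity makes
  this sum nonzero.\<close>

lemma bases_nonorthogonal:
  assumes y: "y \<in> V" and y': "y' \<in> V" and s: "s \<in> indices" and t: "t \<in> indices" and st: "s \<noteq> t"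
  shows "bvec s y \<bullet>c bvec t y' \<noteq> 0"
proof (cases s)
  case None
  then obtain z where z: "t = Some z" using st by (cases t) auto
  have "bvec s y \<bullet>c bvec t y' = (\<Sum>x\<in>V. if x = y then cnj (basis_fun t y' y) else 0)"
    unfolding cscalar_prod_label_vec None by (intro sum.cong) auto
  also have "\<dots> = cnj (basis_fun t y' y)" using y by (simp add: sum.delta')
  finally show ?thesis using basis_fun_Some_nonzero unfolding z by simp
next
  case s': (Some z)
  show ?thesis
  proof (cases t)
    case None
    have "bvec s y \<bullet>c bvec t y' = (\<Sum>x\<in>V. if x = y' then basis_fun s y y' else 0)"
      unfolding cscalar_prod_label_vec None by (intro sum.cong) auto
    also have "\<dots> = basis_fun s y y'" using y' by (simp add: sum.delta')
    finally show ?thesis using basis_fun_Some_nonzero unfolding s' by simp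
  next
    case (Some w)
    have zw: "z \<in> V" "w \<in> V" "z \<noteq> w" using s t st s' Some by auto
    define g where "g x = qphase z x * cnj (qphase w x) * (bit_sign (x \<bullet> y) * bit_sign (x \<bullet> y'))" for x
    \<comment> \<open>The difference of the two Kerdock matrices, written as a sum in characteristic
      2; the linear characters of \<open>y\<close> and \<open>y'\<close> do not affect it.\<close>
    let ?L = "\<lambda>a. kerdock_P p z *\<^sub>v a + kerdock_P p w *\<^sub>v a"
    have "(\<Sum>x\<in>V. g x) \<noteq> 0"
    proof (rule quadratic_sum_nonzero[where L = ?L])
      fix x assume x: "x \<in> V"
      have "g x * cnj (g x) = (qphase z x * cnj (qphase z x)) * (cnj (qphase w x) * qphase w x)
          * ((bit_sign (x \<bullet> y) * bit_sign (x \<bullet> y)) * (bit_sign (x \<bullet> y') * bit_sign (x \<bullet> y')))"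
        by (simp only: g_def complex_cnj_mult complex_cnj_cnj cnj_bit_sign mult_ac)
      thus "g x * cnj (g x) = 1" by simp
    next
      fix x a assume xa: "x \<in> V" "a \<in> V"
      have "bit_sign (x \<bullet> ?L a) = bit_sign (x \<bullet> (kerdock_P p z *\<^sub>v a)) * bit_sign (x \<bullet> (kerdock_P p w *\<^sub>v a))"
        using xa by (simp add: bit_sign_scalar_add[of _ m])
      thus "g (x + a) = g x * g a * bit_sign (x \<bullet> ?L a)"
        using xa y y' by (simp add: g_def qphase_add bit_sign_scalar_add[of _ m] mult_ac)
    next
      fix a assume a: "a \<in> V" "a \<noteq> 0\<^sub>v m"
      have "?L a \<noteq> 0\<^sub>v m"
      proof
        assume "?L a = 0\<^sub>v m"
        hence "?L a + kerdock_P p w *\<^sub>v a = kerdock_P p w *\<^sub>v a" using a by simp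
        thus False using a P_inj[OF zw(1,2) a(1) zw(3) a(2)] by (simp add: bit_vec_add_cancel[of _ m])
      qed
      thus "?L a \<in> carrier_vec m \<and> ?L a \<noteq> 0\<^sub>v m" using a by simp
    qed
    moreover have "bvec s y \<bullet>c bvec t y' = (\<Sum>x\<in>V. g x / 2 ^ m)"
      unfolding cscalar_prod_label_vec s' Some
    proof (rule sum.cong[OF refl])
      fix x
      have "basis_fun (Some z) y x * cnj (basis_fun (Some w) y' x)
          = g x / (complex_of_real (sqrt (2 ^ m)) * complex_of_real (sqrt (2 ^ m)))"
        by (simp only: g_def basis_fun.simps complex_cnj_mult complex_cnj_divide complex_cnj_complex_of_real
            cnj_bit_sign times_divide_times_eq mult_ac)
      thus "basis_fun (Some z) y x * cnj (basis_fun (Some w) y' x) = g x / 2 ^ m"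
        unfolding sqrt_square .
    qed
    ultimately show ?thesis by (simp flip: sum_divide_distrib)
  qed
qed

section \<open>Action of the Pauli matrices on the bases\<close>

lemma pauli_D_None:
  assumes "a \<in> V" "b \<in> V" "y \<in> V"
  shows "pauli_D m a b *\<^sub>v bvec None y = bit_sign (b \<bullet> y) \<cdot>\<^sub>v bvec None (y + a)"
proof -
  have "x + a = y \<longleftrightarrow> x = y + a" if "x \<in> V" for x
    using that assms bit_vec_add_cancel(1)[of _ m a] by metis
  thus ?thesis using assms
    by (auto simp: pauli_D_mult_label_vec smult_label_vec label_vec_eq_iff bit_vec_add_cancel[of _ m])
qed

text \<open>Translating by \<open>a\<close> multiplies the quadratic phase by the linear character
  of \<open>kerdock_P p z *\<^sub>v a\<close>, which joins the characters of \<open>b\<close> and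
  \<open>y\<close>; the remaining new factors do not depend on \<open>x\<close> and form the
  phase.\<close>

lemma pauli_D_Some:
  assumes V: "a \<in> V" "b \<in> V" "y \<in> V"
  shows "\<exists>c\<in>phases. pauli_D m a b *\<^sub>v bvec (Some z) y
    = c \<cdot>\<^sub>v bvec (Some z) (y + (b + kerdock_P p z *\<^sub>v a))"
proof
  let ?c = "bit_sign (b \<bullet> a) * qphase z a * bit_sign (a \<bullet> y)"
  show "?c \<in> phases" by (intro phases_mult) simp_all
  have "bit_sign (b \<bullet> (x + a)) * basis_fun (Some z) y (x + a)
      = ?c * basis_fun (Some z) (y + (b + kerdock_P p z *\<^sub>v a)) x" if x: "x \<in> V" for x
    using V x by (simp add: qphase_add bit_sign_scalar_add[of _ m] comm_scalar_prod[of b m x] mult_ac)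
  thus "pauli_D m a b *\<^sub>v bvec (Some z) y = ?c \<cdot>\<^sub>v bvec (Some z) (y + (b + kerdock_P p z *\<^sub>v a))"
    using V by (simp add: pauli_D_mult_label_vec smult_label_vec label_vec_eq_iff)
qed

end

section \<open>Isometries permuting the lines\<close>

lemma mat_adjoint_carrier: "A \<in> carrier_mat n n \<Longrightarrow> mat_adjoint A \<in> carrier_mat n n"
  unfolding mat_adjoint_def by (intro carrier_matI) auto

lemma mat_adjoint_index:
  "A \<in> carrier_mat n n \<Longrightarrow> i < n \<Longrightarrow> j < n \<Longrightarrow> mat_adjoint A $$ (i, j) = conjugate (A $$ (j, i))"
  unfolding mat_adjoint_def by (auto simp: mat_of_rows_index)

lemma cscalar_prod_mat_adjoint:
  fixes A :: "complex mat"
  assumes A: "A \<in> carrier_mat n n" and v: "v \<in> carrier_vec n" and w: "w \<in> carrier_vec n"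
  shows "(A *\<^sub>v v) \<bullet>c w = v \<bullet>c (mat_adjoint A *\<^sub>v w)"
proof -
  have d: "dim_row (mat_adjoint A) = n" "dim_col (mat_adjoint A) = n"
    using mat_adjoint_carrier[OF A] by auto
  have "(A *\<^sub>v v) \<bullet>c w = (\<Sum>i<n. \<Sum>j<n. A $$ (i, j) * v $ j * cnj (w $ i))"
    using A v w by (auto simp: scalar_prod_def lessThan_atLeast0 sum_distrib_right)
  also have "\<dots> = (\<Sum>j<n. \<Sum>i<n. A $$ (i, j) * v $ j * cnj (w $ i))" by (rule sum.swap)
  also have "\<dots> = v \<bullet>c (mat_adjoint A *\<^sub>v w)"
    using A v w d by (auto simp: scalar_prod_def lessThan_atLeast0 sum_distrib_left
        mat_adjoint_index mult_ac intro!: sum.cong)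
  finally show ?thesis .
qed

lemma unitary_matsD:
  assumes "U \<in> unitary_mats n"
  shows "U \<in> carrier_mat n n" "mat_adjoint U \<in> carrier_mat n n"
    "v \<in> carrier_vec n \<Longrightarrow> mat_adjoint U *\<^sub>v (U *\<^sub>v v) = v"
    "v \<in> carrier_vec n \<Longrightarrow> U *\<^sub>v (mat_adjoint U *\<^sub>v v) = v"
proof -
  show U: "U \<in> carrier_mat n n" using assms by (simp add: unitary_mats_def)
  show A: "mat_adjoint U \<in> carrier_mat n n" by (rule mat_adjoint_carrier[OF U])
  have e: "U * mat_adjoint U = 1\<^sub>m n" "mat_adjoint U * U = 1\<^sub>m n"
    using assms by (simp_all add: unitary_mats_def)
  show "mat_adjoint U *\<^sub>v (U *\<^sub>v v) = v" if "v \<in> carrier_vec n"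
    using assoc_mult_mat_vec[OF A U that] that by (simp add: e)
  show "U *\<^sub>v (mat_adjoint U *\<^sub>v v) = v" if "v \<in> carrier_vec n"
    using assoc_mult_mat_vec[OF U A that] that by (simp add: e)
qed

lemma unitary_isometry:
  assumes U: "U \<in> unitary_mats n" and v: "v \<in> carrier_vec n" and w: "w \<in> carrier_vec n"
  shows "(U *\<^sub>v v) \<bullet>c (U *\<^sub>v w) = v \<bullet>c w"
  using cscalar_prod_mat_adjoint[OF unitary_matsD(1)[OF U] v, of "U *\<^sub>v w"]
    unitary_matsD[OF U] w by auto

lemma unitary_adjoint_isometry:
  assumes U: "U \<in> unitary_mats n" and v: "v \<in> carrier_vec n" and w: "w \<in> carrier_vec n"
  shows "(mat_adjoint U *\<^sub>v v) \<bullet>c (mat_adjoint U *\<^sub>v w) = v \<bullet>c w"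
proof -
  have "mat_adjoint U *\<^sub>v v \<in> carrier_vec n" "mat_adjoint U *\<^sub>v w \<in> carrier_vec n"
    using unitary_matsD(2)[OF U] v w by auto
  from unitary_isometry[OF U this] show ?thesis using unitary_matsD(4)[OF U] v w by simp
qed

lemma cscalar_prod_smult:
  fixes v w :: "complex vec"
  assumes "v \<in> carrier_vec n" "w \<in> carrier_vec n"
  shows "(c \<cdot>\<^sub>v v) \<bullet>c w = c * (v \<bullet>c w)" "v \<bullet>c (c \<cdot>\<^sub>v w) = cnj c * (v \<bullet>c w)"
  using assms by (auto simp: scalar_prod_def sum_distrib_left mult_ac)

lemma smult_mat_mult_vec:
  fixes A :: "complex mat"
  assumes "A \<in> carrier_mat n n" "v \<in> carrier_vec n"
  shows "(c \<cdot>\<^sub>m A) *\<^sub>v v = c \<cdot>\<^sub>v (A *\<^sub>v v)"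
  using assms by (intro eq_vecI) (auto simp: scalar_prod_def sum_distrib_left mult.assoc)

context kerdock
begin

abbreviation N :: nat where "N \<equiv> 2 ^ m"

abbreviation all_lines :: "complex vec set" where
  "all_lines \<equiv> (\<Union>t\<in>indices. lines t)"

lemma linesE:
  assumes "v \<in> lines t"
  obtains c y where "c \<in> phases" "y \<in> V" "v = c \<cdot>\<^sub>v bvec t y"
  using assms by (auto simp: lines_def)

lemma bvec_lines [intro]: "y \<in> V \<Longrightarrow> bvec t y \<in> lines t"
  unfolding lines_def using phases_one by (metis (mono_tags, lifting) mem_Collect_eq one_smult_vec)

lemma smult_lines:
  assumes "c \<in> phases" "v \<in> lines t"
  shows "c \<cdot>\<^sub>v v \<in> lines t"
proof -
  obtain d y where "d \<in> phases" "y \<in> V" "v = d \<cdot>\<^sub>v bvec t y" using linesE[OF assms(2)] .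
  thus ?thesis using phases_mult[OF assms(1)] unfolding lines_def by (auto simp: smult_smult_assoc)
qed

lemma lines_carrier: "v \<in> lines t \<Longrightarrow> v \<in> carrier_vec N"
  by (auto simp: lines_def)

lemma lines_orthogonal_or_proportional:
  assumes "v \<in> lines t" "w \<in> lines t" "v \<bullet>c w \<noteq> 0"
  shows "\<exists>c\<in>phases. w = c \<cdot>\<^sub>v v"
proof -
  obtain c y where v: "c \<in> phases" "y \<in> V" "v = c \<cdot>\<^sub>v bvec t y" using linesE[OF assms(1)] .
  obtain d y' where w: "d \<in> phases" "y' \<in> V" "w = d \<cdot>\<^sub>v bvec t y'" using linesE[OF assms(2)] .
  have "v \<bullet>c w = c * (cnj d * of_bool (y = y'))"
    using v w by (simp add: cscalar_prod_smult[of _ N] basis_orthonormal)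
  hence "y = y'" using assms(3) by (cases "y = y'") auto
  hence "w = (d * cnj c) \<cdot>\<^sub>v v"
    using v w phases_cnj_mult[OF v(1)] by (simp add: smult_smult_assoc mult.assoc)
  moreover have "d * cnj c \<in> phases" using v(1) w(1) by (intro phases_mult phases_cnj)
  ultimately show ?thesis by blast
qed

text \<open>Inner products across distinct bases never vanish, so orthogonality is the test by which
  an isometry recognises a basis.\<close>

lemma orthogonal_same_basis:
  assumes "v \<in> lines s" "w \<in> lines t" "s \<in> indices" "t \<in> indices" "v \<bullet>c w = 0"
  shows "s = t"
proof (rule ccontr)
  assume st: "s \<noteq> t"
  obtain c y where v: "c \<in> phases" "y \<in> V" "v = c \<cdot>\<^sub>v bvec s y" using linesE[OF assms(1)] .
  obtain d y' where w: "d \<in> phases" "y' \<in> V" "w = d \<cdot>\<^sub>v bvec t y'" using linesE[OF assms(2)] .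
  have "v \<bullet>c w = c * (cnj d * (bvec s y \<bullet>c bvec t y'))"
    using v w by (simp add: cscalar_prod_smult[of _ N])
  thus False
    using assms(5) phases_nonzero[OF v(1)] phases_nonzero[OF phases_cnj[OF w(1)]]
      bases_nonorthogonal[OF v(2) w(2) assms(3,4) st] by simp
qed

text \<open>A single vector decides: any other vector of the basis is a multiple of
  \<open>v0\<close> or orthogonal to it, and in the latter case the orthogonal images must share a
  basis.\<close>

lemma isometry_maps_basis:
  assumes A: "A \<in> carrier_mat N N"
    and iso: "\<And>v w. v \<in> carrier_vec N \<Longrightarrow> w \<in> carrier_vec N \<Longrightarrow> (A *\<^sub>v v) \<bullet>c (A *\<^sub>v w) = v \<bullet>c w"
    and lin: "\<And>v. v \<in> all_lines \<Longrightarrow> A *\<^sub>v v \<in> all_lines"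
    and st: "s \<in> indices" "t \<in> indices" and v0: "v0 \<in> lines s" "A *\<^sub>v v0 \<in> lines t" and v: "v \<in> lines s"
  shows "A *\<^sub>v v \<in> lines t"
proof (cases "v0 \<bullet>c v = 0")
  case True
  have "A *\<^sub>v v \<in> all_lines" using lin v st by blast
  then obtain t' where t': "t' \<in> indices" "A *\<^sub>v v \<in> lines t'" by blast
  have "(A *\<^sub>v v0) \<bullet>c (A *\<^sub>v v) = 0" using True iso v0 v lines_carrier by simp
  hence "t = t'" using orthogonal_same_basis[OF v0(2) t'(2) st(2) t'(1)] by simp
  thus ?thesis using t' by simp
next
  case False
  then obtain c where c: "c \<in> phases" "v = c \<cdot>\<^sub>v v0"
    using lines_orthogonal_or_proportional v0 v by blast
  have "A *\<^sub>v v = c \<cdot>\<^sub>v (A *\<^sub>v v0)"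
    unfolding c(2) by (rule mult_mat_vec[OF A lines_carrier[OF v0(1)]])
  thus ?thesis using c v0 smult_lines by simp
qed

section \<open>Bases preserved and diagonalized by Pauli matrices\<close>

lemma pauli_D_lines:
  assumes ab: "a \<in> V" "b \<in> V" and v: "v \<in> lines t"
  shows "pauli_D m a b *\<^sub>v v \<in> lines t"
proof -
  obtain c y where c: "c \<in> phases" "y \<in> V" "v = c \<cdot>\<^sub>v bvec t y" using linesE[OF v] .
  have "pauli_D m a b *\<^sub>v bvec t y \<in> lines t"
  proof (cases t)
    case None
    thus ?thesis using ab c pauli_D_None[OF ab c(2)] by (simp add: smult_lines bvec_lines)
  next
    case (Some z)
    obtain d where "d \<in> phases"
        "pauli_D m a b *\<^sub>v bvec (Some z) y = d \<cdot>\<^sub>v bvec (Some z) (y + (b + kerdock_P p z *\<^sub>v a))"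
      using pauli_D_Some[OF ab c(2)] by blast
    thus ?thesis using ab c Some by (auto intro!: smult_lines bvec_lines)
  qed
  moreover have "pauli_D m a b *\<^sub>v v = c \<cdot>\<^sub>v (pauli_D m a b *\<^sub>v bvec t y)"
    unfolding c(3) by (rule mult_mat_vec[OF pauli_D_carrier label_vec_carrier])
  ultimately show ?thesis using c smult_lines by simp
qed

lemma eigenvector_lines:
  assumes A: "A \<in> carrier_mat N N"
    and e: "\<And>y. y \<in> V \<Longrightarrow> \<exists>l. A *\<^sub>v bvec t y = l \<cdot>\<^sub>v bvec t y" and v: "v \<in> lines t"
  shows "\<exists>l. A *\<^sub>v v = l \<cdot>\<^sub>v v"
proof -
  obtain c y where c: "c \<in> phases" "y \<in> V" "v = c \<cdot>\<^sub>v bvec t y" using linesE[OF v] .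
  obtain l where l: "A *\<^sub>v bvec t y = l \<cdot>\<^sub>v bvec t y" using e c(2) by blast
  have "A *\<^sub>v v = c \<cdot>\<^sub>v (A *\<^sub>v bvec t y)"
    unfolding c(3) by (rule mult_mat_vec[OF A]) simp
  also have "\<dots> = l \<cdot>\<^sub>v v" using c l by (simp add: smult_smult_assoc mult.commute)
  finally show ?thesis by blast
qed

lemma pauli_D_eigen_None:
  assumes "b \<in> V" "v \<in> lines None"
  shows "\<exists>l. pauli_D m (0\<^sub>v m) b *\<^sub>v v = l \<cdot>\<^sub>v v"
  using assms pauli_D_None[of "0\<^sub>v m" b] by (intro eigenvector_lines[OF _ _ assms(2)]) auto

lemma pauli_D_eigen_Some:
  assumes "a \<in> V" "v \<in> lines (Some z)"
  shows "\<exists>l. pauli_D m a (kerdock_P p z *\<^sub>v a) *\<^sub>v v = l \<cdot>\<^sub>v v"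
proof (rule eigenvector_lines[OF _ _ assms(2)])
  fix y assume y: "y \<in> V"
  \<comment> \<open>For this choice of \<open>b\<close> the label is shifted twice by the same
    vector, hence not at all.\<close>
  have "y + (kerdock_P p z *\<^sub>v a + kerdock_P p z *\<^sub>v a) = y"
    using assms(1) y by (simp add: bit_vec_add_cancel[of _ m])
  thus "\<exists>l. pauli_D m a (kerdock_P p z *\<^sub>v a) *\<^sub>v bvec (Some z) y = l \<cdot>\<^sub>v bvec (Some z) y"
    using pauli_D_Some[OF assms(1) P_mult_carrier[OF assms(1)] y, of z z] by auto
qed simp

text \<open>With \<open>a\<close> zero the standard basis serves; otherwise \<open>P_surj\<close>
  solves for the index \<open>z\<close> of the basis.\<close>

lemma pauli_D_eigenbasis:
  assumes "a \<in> V" "b \<in> V"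
  shows "\<exists>t\<in>indices. \<forall>v\<in>lines t. \<exists>l. pauli_D m a b *\<^sub>v v = l \<cdot>\<^sub>v v"
proof (cases "a = 0\<^sub>v m")
  case True
  thus ?thesis using pauli_D_eigen_None assms by blast
next
  case False
  then obtain z where "z \<in> V" "kerdock_P p z *\<^sub>v a = b" using P_surj assms by blast
  thus ?thesis using pauli_D_eigen_Some assms by blast
qed

text \<open>Completeness of the basis recovers each entry of a row from the products of that row
  with the basis vectors.\<close>

lemma mat_eqI_basis:
  assumes A: "A \<in> carrier_mat N N" and B: "B \<in> carrier_mat N N"
    and e: "\<And>y. y \<in> V \<Longrightarrow> A *\<^sub>v bvec t y = B *\<^sub>v bvec t y"
  shows "A = B"
proof (rule eq_rowI)
  fix k assume "k < dim_row B"
  hence k: "k < N" using B by simp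
  have "row A k \<in> carrier_vec N" "row B k \<in> carrier_vec N"
    using A B by (auto intro!: carrier_vecI)
  then obtain r s where rs: "row A k = label_vec m r" "row B k = label_vec m s"
    using ex_label_vec by metis
  have *: "(\<Sum>x\<in>V. r x * basis_fun t y x) = (\<Sum>x\<in>V. s x * basis_fun t y x)" if "y \<in> V" for y
  proof -
    have "row A k \<bullet> bvec t y = row B k \<bullet> bvec t y"
      using arg_cong[OF e[OF that], of "\<lambda>v. v $ k"] A B k by simp
    thus ?thesis by (simp add: rs scalar_prod_label_vec)
  qed
  have expand: "q x' = (\<Sum>y\<in>V. cnj (basis_fun t y x') * (\<Sum>x\<in>V. q x * basis_fun t y x))" if "x' \<in> V" for q x'
  proof -
    have "q x' = (\<Sum>x\<in>V. if x = x' then q x else 0)" using that by (simp add: sum.delta')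
    also have "\<dots> = (\<Sum>x\<in>V. q x * (\<Sum>y\<in>V. basis_fun t y x * cnj (basis_fun t y x')))"
      using that by (intro sum.cong) (auto simp: basis_complete)
    also have "\<dots> = (\<Sum>x\<in>V. \<Sum>y\<in>V. cnj (basis_fun t y x') * (q x * basis_fun t y x))"
      by (simp add: sum_distrib_left mult_ac)
    also have "\<dots> = (\<Sum>y\<in>V. \<Sum>x\<in>V. cnj (basis_fun t y x') * (q x * basis_fun t y x))" by (rule sum.swap)
    finally show ?thesis by (simp add: sum_distrib_left)
  qed
  have "r x = s x" if "x \<in> V" for x
    using expand[OF that, of r] expand[OF that, of s] by (simp add: *)
  thus "row A k = row B k" by (simp add: rs label_vec_eq_iff)
qed (use A B in auto)

text \<open>
  On a basis of common eigenvectors, \<open>E v = d D v\<close> for a single \<open>v\<close> of another basis fixes all the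
  eigenvalues of \<open>E\<close>, because \<open>v\<close> has nonzero inner product with each eigenvector.
\<close>

lemma eigenbasis_determines:
  assumes E: "E \<in> carrier_mat N N" and D: "D \<in> carrier_mat N N"
    and isoE: "\<And>v w. v \<in> carrier_vec N \<Longrightarrow> w \<in> carrier_vec N \<Longrightarrow> (E *\<^sub>v v) \<bullet>c (E *\<^sub>v w) = v \<bullet>c w"
    and isoD: "\<And>v w. v \<in> carrier_vec N \<Longrightarrow> w \<in> carrier_vec N \<Longrightarrow> (D *\<^sub>v v) \<bullet>c (D *\<^sub>v w) = v \<bullet>c w"
    and eE: "\<And>u. u \<in> lines s \<Longrightarrow> \<exists>l. E *\<^sub>v u = l \<cdot>\<^sub>v u"
    and eD: "\<And>u. u \<in> lines s \<Longrightarrow> \<exists>l. D *\<^sub>v u = l \<cdot>\<^sub>v u"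
    and st: "s \<in> indices" "t \<in> indices" "s \<noteq> t"
    and v: "v \<in> lines t" and d: "d \<in> phases" and Ev: "E *\<^sub>v v = d \<cdot>\<^sub>v (D *\<^sub>v v)"
  shows "E = d \<cdot>\<^sub>m D"
proof (rule mat_eqI_basis[where t = s])
  fix y assume y: "y \<in> V"
  let ?u = "bvec s y"
  have u: "?u \<in> lines s" using y by blast
  have vc: "v \<in> carrier_vec N" "D *\<^sub>v v \<in> carrier_vec N" using lines_carrier[OF v] D by auto
  obtain l where l: "E *\<^sub>v ?u = l \<cdot>\<^sub>v ?u" using eE[OF u] by blast
  obtain k where k: "D *\<^sub>v ?u = k \<cdot>\<^sub>v ?u" using eD[OF u] by blast
  \<comment> \<open>The left side equals the inner product of the images under \<open>E\<close>;
    \<open>l\<close> leaves the first argument, and \<open>d\<close> leaves the second one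
    conjugated.\<close>
  have "?u \<bullet>c v = l * (cnj d * (?u \<bullet>c (D *\<^sub>v v)))"
    using isoE[of ?u v] vc by (simp add: l Ev cscalar_prod_smult[of _ N] mult_ac)
  moreover have "?u \<bullet>c v = k * (?u \<bullet>c (D *\<^sub>v v))"
    using isoD[of ?u v] vc by (simp add: k cscalar_prod_smult[of _ N])
  moreover have "?u \<bullet>c v \<noteq> 0" using orthogonal_same_basis[OF u v] st by blast
  ultimately have "k = l * cnj d" by auto
  hence "l = d * k" using phases_cnj_mult[OF d] by (simp add: mult_ac)
  thus "E *\<^sub>v ?u = (d \<cdot>\<^sub>m D) *\<^sub>v ?u"
    by (simp add: smult_mat_mult_vec[OF D] l k smult_smult_assoc)
qed (use E D in auto)

text \<open>Since \<open>E\<close> preserves a second basis, it sends the vector with label 0 there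
  to a phase times a basis vector. The label of the latter selects a Pauli matrix that is diagonal
  in basis \<open>s\<close> and has the same effect on that vector up to a phase, so
  \<open>eigenbasis_determines\<close> applies.\<close>

lemma heisenberg_weylI:
  assumes E: "E \<in> carrier_mat N N"
    and iso: "\<And>v w. v \<in> carrier_vec N \<Longrightarrow> w \<in> carrier_vec N \<Longrightarrow> (E *\<^sub>v v) \<bullet>c (E *\<^sub>v w) = v \<bullet>c w"
    and lin: "\<And>t v. t \<in> indices \<Longrightarrow> v \<in> lines t \<Longrightarrow> E *\<^sub>v v \<in> lines t"
    and s: "s \<in> indices" and eig: "\<And>v. v \<in> lines s \<Longrightarrow> \<exists>l. E *\<^sub>v v = l \<cdot>\<^sub>v v"
  shows "E \<in> heisenberg_weyl m"
proof -
  have "\<exists>a\<in>V. \<exists>b\<in>V. \<exists>t\<in>indices. \<exists>v\<in>lines t. \<exists>d\<in>phases. s \<noteq> t \<and> E *\<^sub>v v = d \<cdot>\<^sub>v (pauli_D m a b *\<^sub>v v)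
      \<and> (\<forall>u\<in>lines s. \<exists>l. pauli_D m a b *\<^sub>v u = l \<cdot>\<^sub>v u)"
  proof (cases s)
    case None
    \<comment> \<open>The matrix \<open>pauli_D m (0\<^sub>v m) y\<close> is diagonal in the
      standard basis and, up to phases, shifts the labels of every basis \<open>Some z\<close> by
      \<open>y\<close>; index 0 is one choice of second basis.\<close>
    let ?t = "Some (0\<^sub>v m)" and ?v = "bvec (Some (0\<^sub>v m)) (0\<^sub>v m)"
    have t: "?t \<in> indices" "?v \<in> lines ?t" by auto
    obtain c y where c: "c \<in> phases" "y \<in> V" "E *\<^sub>v ?v = c \<cdot>\<^sub>v bvec ?t y"
      using linesE[OF lin[OF t]] .
    obtain d where d: "d \<in> phases" "pauli_D m (0\<^sub>v m) y *\<^sub>v ?v = d \<cdot>\<^sub>v bvec ?t y"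
      using pauli_D_Some[of "0\<^sub>v m" y "0\<^sub>v m" "0\<^sub>v m"] c by auto
    have "E *\<^sub>v ?v = (c * cnj d) \<cdot>\<^sub>v (pauli_D m (0\<^sub>v m) y *\<^sub>v ?v)"
      using phases_cnj_mult[OF d(1)] by (simp add: c d smult_smult_assoc mult.assoc)
    moreover have "c * cnj d \<in> phases" using c d by (intro phases_mult phases_cnj)
    ultimately show ?thesis using None t c pauli_D_eigen_None
      by (intro bexI[of _ "0\<^sub>v m"] bexI[of _ y] bexI[of _ ?t] bexI[of _ ?v] bexI[of _ "c * cnj d"]) auto
  next
    case (Some z)
    let ?v = "bvec None (0\<^sub>v m)"
    have t: "None \<in> indices" "?v \<in> lines None" by auto
    obtain c a where c: "c \<in> phases" "a \<in> V" "E *\<^sub>v ?v = c \<cdot>\<^sub>v bvec None a"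
      using linesE[OF lin[OF t]] .
    \<comment> \<open>The first argument is read off from the image of the standard basis vector at
      0; the second makes the matrix diagonal in basis \<open>Some z\<close>.\<close>
    let ?D = "pauli_D m a (kerdock_P p z *\<^sub>v a)" and ?d = "bit_sign ((kerdock_P p z *\<^sub>v a) \<bullet> 0\<^sub>v m)"
    have d: "?D *\<^sub>v ?v = ?d \<cdot>\<^sub>v bvec None a"
      using pauli_D_None[of a "kerdock_P p z *\<^sub>v a" "0\<^sub>v m"] c by simp
    have "E *\<^sub>v ?v = (c * ?d) \<cdot>\<^sub>v (?D *\<^sub>v ?v)"
      unfolding d c(3) by (simp add: smult_smult_assoc mult.assoc)
    moreover have "c * ?d \<in> phases" using c by (intro phases_mult) auto
    ultimately show ?thesis using Some t c pauli_D_eigen_Some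
      by (intro bexI[of _ a] bexI[of _ "kerdock_P p z *\<^sub>v a"] bexI[of _ None] bexI[of _ ?v] bexI[of _ "c * ?d"]) auto
  qed
  then obtain a b t v d where ab: "a \<in> V" "b \<in> V" and t: "t \<in> indices" "s \<noteq> t" "v \<in> lines t" and d: "d \<in> phases"
    and Ev: "E *\<^sub>v v = d \<cdot>\<^sub>v (pauli_D m a b *\<^sub>v v)"
    and eD: "\<forall>u\<in>lines s. \<exists>l. pauli_D m a b *\<^sub>v u = l \<cdot>\<^sub>v u" by blast
  have "E = d \<cdot>\<^sub>m pauli_D m a b"
    by (rule eigenbasis_determines[OF E pauli_D_carrier iso pauli_D_isometry[OF ab] eig _ s t(1,2,3) d Ev])
      (use eD in auto)
  thus ?thesis using ab d unfolding heisenberg_weyl_def phases_iff_power by blast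
qed

text \<open>The adjoint of \<open>U\<close> carries a basis \<open>t\<close> into some basis
  \<open>s\<close>, the Pauli matrix preserves \<open>s\<close>, and \<open>U\<close> carries
  \<open>s\<close> back into \<open>t\<close>. If \<open>s\<close> is an eigenbasis of the Pauli
  matrix, then its image under \<open>U\<close> lies in a basis that is an eigenbasis of the
  conjugate.\<close>

lemma clifford_of_line_permutation:
  assumes U: "U \<in> unitary_mats N"
    and fwd: "\<And>v. v \<in> all_lines \<Longrightarrow> U *\<^sub>v v \<in> all_lines"
    and bwd: "\<And>v. v \<in> all_lines \<Longrightarrow> mat_adjoint U *\<^sub>v v \<in> all_lines"
  shows "U \<in> clifford m"
proof -
  let ?A = "mat_adjoint U"
  note UC = unitary_matsD[OF U]
  have "U * pauli_D m a b * ?A \<in> heisenberg_weyl m" if ab: "a \<in> V" "b \<in> V" for a b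
  proof -
    let ?D = "pauli_D m a b" and ?E = "U * pauli_D m a b * ?A"
    have E: "?E \<in> carrier_mat N N" using UC by (intro mult_carrier_mat[of _ N N]) simp_all
    have Ev: "?E *\<^sub>v v = U *\<^sub>v (?D *\<^sub>v (?A *\<^sub>v v))" if v: "v \<in> carrier_vec N" for v
    proof -
      have Av: "?A *\<^sub>v v \<in> carrier_vec N" using UC(2) v by auto
      have "?E *\<^sub>v v = (U * ?D) *\<^sub>v (?A *\<^sub>v v)"
        by (rule assoc_mult_mat_vec[OF mult_carrier_mat[OF UC(1) pauli_D_carrier] UC(2) v])
      also have "\<dots> = U *\<^sub>v (?D *\<^sub>v (?A *\<^sub>v v))" by (rule assoc_mult_mat_vec[OF UC(1) _ Av]) simp
      finally show ?thesis .
    qed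
    have Dc: "?D *\<^sub>v v \<in> carrier_vec N" if "v \<in> carrier_vec N" for v
      by (rule mult_mat_vec_carrier[OF pauli_D_carrier that])
    have Ac: "?A *\<^sub>v v \<in> carrier_vec N" if "v \<in> carrier_vec N" for v
      by (rule mult_mat_vec_carrier[OF UC(2) that])
    have iso: "(?E *\<^sub>v v) \<bullet>c (?E *\<^sub>v w) = v \<bullet>c w" if "v \<in> carrier_vec N" "w \<in> carrier_vec N" for v w
      using that by (simp add: Ev Dc Ac unitary_isometry[OF U] pauli_D_isometry[OF ab]
          unitary_adjoint_isometry[OF U])
    have lin: "?E *\<^sub>v v \<in> lines t" if t: "t \<in> indices" and v: "v \<in> lines t" for t v
    proof -
      have vc: "v \<in> carrier_vec N" using v by (rule lines_carrier)
      have "?A *\<^sub>v v \<in> all_lines" using bwd t v by blast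
      then obtain s where s: "s \<in> indices" "?A *\<^sub>v v \<in> lines s" by blast
      \<comment> \<open>The reference vector for \<open>isometry_maps_basis\<close>: its image under
        \<open>U\<close> is \<open>v\<close> itself, so \<open>U\<close> maps all of basis
        \<open>s\<close> into basis \<open>t\<close>.\<close>
      have Uv: "U *\<^sub>v (?A *\<^sub>v v) \<in> lines t" using UC(4)[OF vc] v by simp
      have "U *\<^sub>v (?D *\<^sub>v (?A *\<^sub>v v)) \<in> lines t"
        by (rule isometry_maps_basis[where s = s and ?v0.0 = "?A *\<^sub>v v"])
          (fact UC(1), erule (1) unitary_isometry[OF U], erule fwd, fact+, rule pauli_D_lines[OF ab s(2)])
      thus ?thesis by (simp add: Ev[OF vc])
    qed
    obtain s where s: "s \<in> indices" and eD: "\<forall>v\<in>lines s. \<exists>l. ?D *\<^sub>v v = l \<cdot>\<^sub>v v"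
      using pauli_D_eigenbasis[OF ab] by blast
    let ?v0 = "bvec s (0\<^sub>v m)"
    have v0: "?v0 \<in> lines s" by (rule bvec_lines) simp
    then obtain t where t: "t \<in> indices" "U *\<^sub>v ?v0 \<in> lines t" using fwd[of ?v0] s by blast
    \<comment> \<open>The reference vector for the adjoint, which therefore maps all of basis
      \<open>t\<close> into the eigenbasis \<open>s\<close>.\<close>
    have A0: "?A *\<^sub>v (U *\<^sub>v ?v0) \<in> lines s" using v0 by (simp add: UC(3))
    have "\<exists>l. ?E *\<^sub>v w = l \<cdot>\<^sub>v w" if w: "w \<in> lines t" for w
    proof -
      have wc: "w \<in> carrier_vec N" using w by (rule lines_carrier)
      have "?A *\<^sub>v w \<in> lines s"
        by (rule isometry_maps_basis[where s = t and ?v0.0 = "U *\<^sub>v ?v0"])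
          (fact UC(2), erule (1) unitary_adjoint_isometry[OF U], erule bwd, fact+)
      then obtain l where "?D *\<^sub>v (?A *\<^sub>v w) = l \<cdot>\<^sub>v (?A *\<^sub>v w)" using eD by blast
      hence "?E *\<^sub>v w = U *\<^sub>v (l \<cdot>\<^sub>v (?A *\<^sub>v w))" by (simp add: Ev[OF wc])
      also have "\<dots> = l \<cdot>\<^sub>v (U *\<^sub>v (?A *\<^sub>v w))" by (rule mult_mat_vec[OF UC(1) Ac[OF wc]])
      finally show ?thesis using UC(4)[OF wc] by auto
    qed
    thus ?thesis by (intro heisenberg_weylI[OF E iso lin t(1)])
  qed
  thus ?thesis using U by (simp add: clifford_def)
qed

section \<open>Columns of the Kerdock matrix and the action of a symmetry\<close>

lemma col_kerdock_basis:
  assumes l: "l < N"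
  shows "col (kerdock_basis p z) l = bvec (Some z) (bin_label m l)"
proof -
  have H: "walsh_hadamard m \<in> carrier_mat N N" by (simp add: walsh_hadamard_def)
  have "kerdock_basis p z = mat N N (\<lambda>(k, l). qphase z (bin_label m k) * walsh_hadamard m $$ (k, l))"
    by (simp add: kerdock_basis_def deg mat_diag_mult_left[OF H] qphase_def)
  thus ?thesis using l
    by (intro eq_vecI) (simp_all add: label_vec_def walsh_hadamard_def bit_sign_def)
qed

lemma unit_vec_bvec:
  assumes l: "l < N"
  shows "unit_vec N l = bvec None (bin_label m l)"
proof (rule eq_vecI)
  fix k assume "k < dim_vec (bvec None (bin_label m l))"
  hence k: "k < N" by (simp add: label_vec_def)
  have "bin_label m k = bin_label m l \<longleftrightarrow> k = l"
    using bij_bin_label[of m] k l by (auto simp: bij_betw_def inj_on_def)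
  thus "unit_vec N l $ k = bvec None (bin_label m l) $ k" using k l by (simp add: label_vec_def)
qed (simp add: label_vec_def)

text \<open>Block indices and column labels both run through the enumeration
  \<open>bin_label\<close>, so all bases are exhausted. The order of the columns is dropped, as a
  symmetry may permute them anyway.\<close>

lemma set_cols_kerdock_mubs:
  "set (cols (kerdock_mubs p)) = {bvec t y | t y. t \<in> indices \<and> y \<in> V}"
  "dim_row (kerdock_mubs p) = N"
proof -
  let ?Bs = "1\<^sub>m N # map (\<lambda>k. kerdock_basis p (bin_label m k)) [0..<N]"
  have M: "kerdock_mubs p = mat_of_cols N (concat (map cols ?Bs))"
    by (simp add: kerdock_mubs_def Let_def hconcat_def deg)
  show "dim_row (kerdock_mubs p) = N" by (simp add: M)
  have lab: "bin_label m ` {0..<N} = V"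
    using bij_bin_label[of m] by (simp add: bij_betw_def atLeast0LessThan)
  have colset: "set (cols A) = col A ` {0..<N}" if "A \<in> carrier_mat N N" for A :: "complex mat"
    using that by (simp add: cols_def)
  have K: "kerdock_basis p z \<in> carrier_mat N N" for z
    unfolding kerdock_basis_def by (intro mult_carrier_mat[of _ N N]) (simp_all add: deg walsh_hadamard_def)
  have img: "col A ` {0..<N} = bvec t ` V" if "\<And>l. l < N \<Longrightarrow> col A l = bvec t (bin_label m l)" for A t
    unfolding lab[symmetric] image_image using that by (intro image_cong) auto
  have "set (cols (1\<^sub>m N)) = bvec None ` V"
    unfolding colset[OF one_carrier_mat] by (rule img) (simp add: unit_vec_bvec)
  moreover have "set (cols (kerdock_basis p z)) = bvec (Some z) ` V" for z
    unfolding colset[OF K] by (rule img) (rule col_kerdock_basis)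
  ultimately have "set (concat (map cols ?Bs)) = bvec None ` V \<union> (\<Union>z\<in>bin_label m ` {0..<N}. bvec (Some z) ` V)"
    by simp
  also have "\<dots> = {bvec t y | t y. t \<in> indices \<and> y \<in> V}" unfolding lab by auto
  finally have S: "set (concat (map cols ?Bs)) = {bvec t y | t y. t \<in> indices \<and> y \<in> V}" .
  have "set (concat (map cols ?Bs)) \<subseteq> carrier_vec N" unfolding S by auto
  thus "set (cols (kerdock_mubs p)) = {bvec t y | t y. t \<in> indices \<and> y \<in> V}"
    unfolding M by (subst cols_mat_of_cols) (simp_all only: S)
qed

end

text \<open>Column \<open>j\<close> of \<open>M * G\<close> is \<open>d j\<close> times column
  \<open>\<pi> j\<close> of \<open>M\<close>, so the symmetry equation can be read column by column.
  As to direction, \<open>U\<close> takes column \<open>\<pi> j\<close> to a multiple of column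
  \<open>j\<close>.\<close>

lemma symmetry_permutes_cols:
  assumes sym: "is_symmetry M U G" and n: "dim_col M = n"
  shows "\<exists>\<pi> d. \<pi> permutes {..<n} \<and> (\<forall>j<n. d j \<in> phases \<and> d j \<cdot>\<^sub>v (U *\<^sub>v col M (\<pi> j)) = col M j)"
proof -
  obtain Q D where Q: "Q \<in> permutation_mats n" and D: "D \<in> quaternary_diag_mats n" and QD: "G = Q * D"
    and UMG: "U * M * G = M" and U: "U \<in> carrier_mat (dim_row M) (dim_row M)"
    using sym unfolding is_symmetry_def n unitary_mats_def by blast
  obtain \<pi> where \<pi>: "\<pi> permutes {..<n}" "Q = mat n n (\<lambda>(i, j). if i = \<pi> j then 1 else 0)"
    using Q unfolding permutation_mats_def by blast
  obtain d where d: "\<forall>j<n. d j \<in> phases" "D = mat_diag n d"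
    using D unfolding quaternary_diag_mats_def phases_def by blast
  note G = QD[unfolded \<pi>(2) d(2)]
  have M: "M \<in> carrier_mat (dim_row M) n" using n by auto
  have G': "G = mat n n (\<lambda>(i, j). (if i = \<pi> j then 1 else 0) * d j)"
    unfolding G by (subst mat_diag_mult_right) (auto intro!: eq_matI)
  have Gc: "G \<in> carrier_mat n n" by (simp add: G')
  have "d j \<cdot>\<^sub>v (U *\<^sub>v col M (\<pi> j)) = col M j" if j: "j < n" for j
  proof -
    have \<pi>j: "\<pi> j < n" using permutes_in_image[OF \<pi>(1)] j by auto
    have MGj: "col (M * G) j = d j \<cdot>\<^sub>v col M (\<pi> j)"
    proof (rule eq_vecI)
      fix i assume "i < dim_vec (d j \<cdot>\<^sub>v col M (\<pi> j))"
      hence i: "i < dim_row M" by simp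
      have "col (M * G) j $ i = (\<Sum>k<n. M $$ (i, k) * ((if k = \<pi> j then 1 else 0) * d j))"
        using i j n by (simp add: G' scalar_prod_def lessThan_atLeast0)
      also have "\<dots> = (\<Sum>k<n. if k = \<pi> j then M $$ (i, k) * d j else 0)" by (intro sum.cong) auto
      also have "\<dots> = M $$ (i, \<pi> j) * d j" using \<pi>j by (simp add: sum.delta')
      finally show "col (M * G) j $ i = (d j \<cdot>\<^sub>v col M (\<pi> j)) $ i" using i \<pi>j n by (simp add: mult.commute)
    qed simp
    have UMG': "U * (M * G) = M" by (rule trans[OF assoc_mult_mat[OF U M Gc, symmetric] UMG])
    have "col M j = col (U * (M * G)) j" unfolding UMG' ..
    also have "\<dots> = U *\<^sub>v col (M * G) j" by (rule col_mult2[OF U mult_carrier_mat[OF M Gc] j])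
    also have "\<dots> = U *\<^sub>v (d j \<cdot>\<^sub>v col M (\<pi> j))" unfolding MGj ..
    also have "\<dots> = d j \<cdot>\<^sub>v (U *\<^sub>v col M (\<pi> j))" by (rule mult_mat_vec[OF U]) simp
    finally show ?thesis ..
  qed
  thus ?thesis using \<pi>(1) d(1) by blast
qed

theorem lemma20:
  fixes m :: nat and p :: "bit poly" and U G :: "complex mat"
  assumes "m \<ge> 1"
    and "degree p = m" and "primitive_irred p"
    and "is_symmetry (kerdock_mubs p) U G"
  shows "U \<in> clifford m"
proof -
  interpret kerdock p m using assms by unfold_locales
  let ?M = "kerdock_mubs p" and ?A = "mat_adjoint U"
  define n where "n = dim_col ?M"
  have U: "U \<in> unitary_mats N"
    using assms(4) by (simp add: is_symmetry_def set_cols_kerdock_mubs(2))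
  note UC = unitary_matsD[OF U]
  obtain \<pi> d where \<pi>: "\<pi> permutes {..<n}" and d: "\<And>j. j < n \<Longrightarrow> d j \<in> phases"
    and col: "\<And>j. j < n \<Longrightarrow> d j \<cdot>\<^sub>v (U *\<^sub>v col ?M (\<pi> j)) = col ?M j"
    using symmetry_permutes_cols[OF assms(4) n_def[symmetric]] by blast
  have cols: "col ?M ` {..<n} = {bvec t y | t y. t \<in> indices \<and> y \<in> V}"
    using set_cols_kerdock_mubs(1) by (simp add: cols_def n_def atLeast0LessThan)
  have colc: "col ?M j \<in> carrier_vec N" for j
    using set_cols_kerdock_mubs(2) by (metis col_dim)
  have col_lines: "c \<cdot>\<^sub>v col ?M j \<in> all_lines" if "j < n" "c \<in> phases" for c j
  proof -
    have "col ?M j \<in> {bvec t y | t y. t \<in> indices \<and> y \<in> V}" unfolding cols[symmetric] using that by auto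
    thus ?thesis using that(2) by (auto simp: lines_def)
  qed
  have line_col: "\<exists>c\<in>phases. \<exists>j<n. v = c \<cdot>\<^sub>v col ?M j" if v: "v \<in> all_lines" for v
  proof -
    obtain t where t: "t \<in> indices" "v \<in> lines t" using v by blast
    then obtain c y where c: "c \<in> phases" "y \<in> V" "v = c \<cdot>\<^sub>v bvec t y" by (auto elim: linesE)
    have "bvec t y \<in> col ?M ` {..<n}" unfolding cols using t(1) c(2) by blast
    then obtain j where "j < n" "bvec t y = col ?M j" by auto
    thus ?thesis using c(1,3) by metis
  qed
  have Ucol: "U *\<^sub>v col ?M (\<pi> j) = cnj (d j) \<cdot>\<^sub>v col ?M j" if "j < n" for j
    unfolding col[OF that, symmetric] using phases_cnj_mult[OF d[OF that]] by (simp add: smult_smult_assoc)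
  show ?thesis
  proof (rule clifford_of_line_permutation[OF U])
    fix v assume "v \<in> all_lines"
    then obtain c i where c: "c \<in> phases" "i < n" "v = c \<cdot>\<^sub>v col ?M i" using line_col by blast
    \<comment> \<open>The images under \<open>U\<close> are known for columns
      \<open>\<pi> j\<close>, so the index is first pulled back along the permutation.\<close>
    obtain j where j: "j < n" "i = \<pi> j"
      using permutes_image[OF \<pi>] c(2) by (metis imageE lessThan_iff)
    have "U *\<^sub>v v = c \<cdot>\<^sub>v (U *\<^sub>v col ?M (\<pi> j))"
      unfolding c(3) j(2) by (rule mult_mat_vec[OF UC(1) colc])
    also have "\<dots> = (c * cnj (d j)) \<cdot>\<^sub>v col ?M j" by (simp add: Ucol[OF j(1)] smult_smult_assoc)
    finally show "U *\<^sub>v v \<in> all_lines" using col_lines[OF j(1)] c(1) d[OF j(1)] phases_mult phases_cnj by metis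
  next
    fix v assume "v \<in> all_lines"
    then obtain c j where c: "c \<in> phases" "j < n" "v = c \<cdot>\<^sub>v col ?M j" using line_col by blast
    have \<pi>j: "\<pi> j < n" using permutes_in_image[OF \<pi>] c(2) by auto
    \<comment> \<open>Column \<open>j\<close> is rewritten as a multiple of the image of column
      \<open>\<pi> j\<close> under \<open>U\<close>, which the adjoint undoes.\<close>
    have "?A *\<^sub>v v = c \<cdot>\<^sub>v (?A *\<^sub>v (d j \<cdot>\<^sub>v (U *\<^sub>v col ?M (\<pi> j))))"
      unfolding c(3) col[OF c(2)] by (rule mult_mat_vec[OF UC(2) colc])
    also have "?A *\<^sub>v (d j \<cdot>\<^sub>v (U *\<^sub>v col ?M (\<pi> j))) = d j \<cdot>\<^sub>v (?A *\<^sub>v (U *\<^sub>v col ?M (\<pi> j)))"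
      using UC(1) colc by (intro mult_mat_vec[OF UC(2)] mult_mat_vec_carrier)
    also have "?A *\<^sub>v (U *\<^sub>v col ?M (\<pi> j)) = col ?M (\<pi> j)" by (rule UC(3)[OF colc])
    finally have "?A *\<^sub>v v = (c * d j) \<cdot>\<^sub>v col ?M (\<pi> j)" by (simp add: smult_smult_assoc)
    thus "?A *\<^sub>v v \<in> all_lines" using col_lines[OF \<pi>j] c(1) d[OF c(2)] phases_mult by metis
  qed
qed

end
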